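(* Let $\hat{\mathcal{A}}$ be the set-theoretic Yang-Baxter algebra built on the quandle algebra $\mathcal{A}$, where $(X,\bullet,e)$ is a group and $q:X\to\mathcal{A}$, $a\mapsto q_a$, satisfies $q_aq_b=q_{a\bullet b}$ for all $a,b\in X$. Let $\mathcal{R}=\sum_{b\in X}h_b\otimes q_b$ be the rack universal $\mathcal{R}$-matrix, and let $(\mathcal{A},\Delta,\epsilon,S,\mathcal{R})$ be the quasi-triangular Hopf algebra with $\Delta(q_a^{\pm1})=q_a^{\pm1}\otimes q_a^{\pm1}$, $\Delta(h_a)=\sum_{b\bullet c=a}h_b\otimes h_c$, $\epsilon(q_a^{\pm1})=1$, $\epsilon(h_a)=\delta_{a,e}$, $S(q_a^{\pm1})=q_a^{\mp1}$, $S(h_a)=h_{a^*}$ ($a^*$ the inverse of $a$ in $(X,\bullet)$). Suppose also that for all $a,b,x\in X$, $$\sigma_x(a)\bullet\sigma_x(b)=\sigma_x(a\bullet b).$$ Then: (1) $(\hat{\mathcal{A}},\Delta,\epsilon,S)$ is a Hopf algebra (with $\Delta,\epsilon,S$ extending those of $\mathcal{A}$) with $\Delta(w_a)=w_a\otimes w_a$ for all $a\in X$. (2) $\Delta(w_a)\mathcal{R}=\mathcal{R}\Delta(w_a)$ for all $a\in X$.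
   Context: Quandle algebra: let $(X,\triangleright)$ be a magma that is finite, or such that $b\mapsto a\triangleright b$ is surjective for every $a\in X$. The rack algebra is a unital associative algebra $\mathcal{A}$ over a field $k$ generated by indeterminates $1_{\mathcal{A}}$, $q_a,q_a^{-1},h_a$ ($a\in X$), with $h_a=h_b\Leftrightarrow a=b$, and relations $q_a^{-1}q_a=q_aq_a^{-1}=1_{\mathcal{A}}$, $q_aq_b=q_bq_{b\triangleright a}$, $h_ah_b=\delta_{a,b}h_a^2$, $q_bh_{b\triangleright a}=h_aq_b$. It is a quandle algebra if there is a left quasigroup $(X,\bullet)$ with $a\bullet b=b\bullet(b\triangleright a)$ for all $a,b\in X$. Set-theoretic Yang-Baxter algebra: let $\mathcal{A}$ be the quandle algebra and let $\sigma_a,\tau_b:X\to X$ be maps with every $\sigma_a$ bijective. It is the unital associative $k$-algebra $\hat{\mathcal{A}}$ generated by $1_{\hat{\mathcal{A}}}$, $q_a,q_a^{-1},h_a$ and $w_a,w_a^{-1}$ ($a\in X$), with $h_a=h_b\Leftrightarrow a=b$, and relations, for all $a,b\in X$: $q_a^{-1}q_a=q_aq_a^{-1}=1_{\hat{\mathcal{A}}}$, $q_aq_b=q_bq_{b\triangleright a}$, $h_ah_b=\delta_{a,b}h_a$, $q_bh_{b\triangleright a}=h_aq_b$, $w_a^{-1}w_a=w_aw_a^{-1}=1_{\hat{\mathcal{A}}}$, $w_aw_b=w_{\sigma_a(b)}w_{\tau_b(a)}$, $w_ah_b=h_{\sigma_a(b)}w_a$, $w_aq_b=q_{\sigma_a(b)}w_a$.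 Standing conventions: $\sum_{a\in X}h_a=1$ (the unit of $\mathcal{A}$, respectively $\hat{\mathcal{A}}$), so $h_a^2=h_a$; $X$ is finite or countably infinite (for infinite $X$ sums over $X$ are understood formally). *)

theory Defs
  imports Complex_Main "HOL-Library.Poly_Mapping" "HOL-Library.Countable"
begin

section \<open>Algebras presented by generators and relations\<close>

text \<open>Words over an alphabet form a monoid under concatenation. It is written additively because
  finitely supported functions multiply by convolution over an additive monoid of keys; so
  \<^typ>\<open>'g list \<Rightarrow>\<^sub>0 'k\<close> is the free unital associative algebra on the type \<open>'g\<close>.\<close>

instantiation list :: (type) monoid_add
begin
definition zero_list :: "'a list" where "zero_list = []"
definition plus_list :: "'a list \<Rightarrow> 'a list \<Rightarrow> 'a list" where "plus_list = (@)"
instance by standard (simp_all add: zero_list_def plus_list_def)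
end

locale k_algebra = vector_space scale
  for scale :: "'k::field \<Rightarrow> 'a::ring_1 \<Rightarrow> 'a" +
  assumes scale_mult_left: "scale c x * y = scale c (x * y)"
    and scale_mult_right: "x * scale c y = scale c (x * y)"

definition algebra_hom ::
  "('k::field \<Rightarrow> 'a::ring_1 \<Rightarrow> 'a) \<Rightarrow> ('k \<Rightarrow> 'b::ring_1 \<Rightarrow> 'b) \<Rightarrow> ('a \<Rightarrow> 'b) \<Rightarrow> bool" where
  "algebra_hom s s' f \<longleftrightarrow> Vector_Spaces.linear s s' f \<and> f 1 = 1 \<and> (\<forall>x y. f (x * y) = f x * f y)"

definition monomial :: "'g list \<Rightarrow> ('g list \<Rightarrow>\<^sub>0 'k::field)" where
  "monomial w = Poly_Mapping.single w 1"

definition evaluate :: "('k::field \<Rightarrow> 'a::ring_1 \<Rightarrow> 'a) \<Rightarrow> ('g \<Rightarrow> 'a) \<Rightarrow> ('g list \<Rightarrow>\<^sub>0 'k) \<Rightarrow> 'a" where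
  "evaluate s g p = (\<Sum>w\<in>Poly_Mapping.keys p. s (Poly_Mapping.lookup p w) (prod_list (map g w)))"

text \<open>The two-sided ideal generated by the relations \<open>Rel\<close> together with \<open>\<Sum>\<^sub>a h\<^sub>a = 1\<close>, where
  \<open>H a\<close> is the letter standing for \<open>h\<^sub>a\<close>. For a finite index type the last relation is an element of
  the free algebra. For an infinite one the sum is formal: \<open>p\<close> is the formal sum of the \<open>h\<^sub>a p\<close>, so
  that \<open>p\<close> vanishes as soon as every \<open>h\<^sub>a p\<close> does.\<close>

inductive_set relation_ideal :: "('x \<Rightarrow> 'g) \<Rightarrow> ('g list \<Rightarrow>\<^sub>0 'k::field) set \<Rightarrow> ('g list \<Rightarrow>\<^sub>0 'k) set"
  for H :: "'x \<Rightarrow> 'g" and Rel :: "('g list \<Rightarrow>\<^sub>0 'k) set" where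
  relation: "r \<in> Rel \<Longrightarrow> r \<in> relation_ideal H Rel"
| unit_sum: "finite (UNIV :: 'x set) \<Longrightarrow> (\<Sum>a\<in>UNIV. monomial [H a]) - 1 \<in> relation_ideal H Rel"
| formal_unit_sum: "infinite (UNIV :: 'x set) \<Longrightarrow> (\<And>a. monomial [H a] * p \<in> relation_ideal H Rel)
    \<Longrightarrow> p \<in> relation_ideal H Rel"
| zero: "0 \<in> relation_ideal H Rel"
| add: "p \<in> relation_ideal H Rel \<Longrightarrow> r \<in> relation_ideal H Rel \<Longrightarrow> p + r \<in> relation_ideal H Rel"
| mult_left: "p \<in> relation_ideal H Rel \<Longrightarrow> r * p \<in> relation_ideal H Rel"
| mult_right: "p \<in> relation_ideal H Rel \<Longrightarrow> p * r \<in> relation_ideal H Rel"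

text \<open>The algebra \<open>'a\<close> is, via the generators \<open>g\<close>, the quotient of the free algebra by
  \<^term>\<open>relation_ideal H Rel\<close>.\<close>

definition presented_by ::
  "('k::field \<Rightarrow> 'a::ring_1 \<Rightarrow> 'a) \<Rightarrow> ('g \<Rightarrow> 'a) \<Rightarrow> ('x \<Rightarrow> 'g) \<Rightarrow> ('g list \<Rightarrow>\<^sub>0 'k) set \<Rightarrow> bool" where
  "presented_by s g H Rel \<longleftrightarrow>
     k_algebra s \<and> surj (evaluate s g) \<and> {p. evaluate s g p = 0} = relation_ideal H Rel"


section \<open>Quandle algebras and set-theoretic Yang-Baxter algebras\<close>

text \<open>The relations of the quandle algebra on letters \<open>Q\<close>, \<open>Qi\<close>, \<open>H\<close> (for \<open>q\<^sub>a\<close>, its inverse, and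
  \<open>h\<^sub>a\<close>), with \<open>h\<^sub>a\<close> idempotent, and with the relation \<open>q\<^sub>a q\<^sub>b = q\<^sub>a\<^sub>\<bullet>\<^sub>b\<close>; \<open>rhd\<close> and \<open>bul\<close> stand for
  \<open>\<triangleright>\<close> and \<open>\<bullet>\<close>. That last relation has to be imposed: the others are
  homogeneous for the grading in which \<open>q\<^sub>a\<close> has degree \<open>1\<close>, its inverse degree \<open>-1\<close> and \<open>h\<^sub>a\<close> degree
  \<open>0\<close>, so they do not imply it.\<close>

definition quandle_relations ::
  "('x \<Rightarrow> 'x \<Rightarrow> 'x) \<Rightarrow> ('x \<Rightarrow> 'x \<Rightarrow> 'x) \<Rightarrow> ('x \<Rightarrow> 'g) \<Rightarrow> ('x \<Rightarrow> 'g) \<Rightarrow> ('x \<Rightarrow> 'g)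
    \<Rightarrow> ('g list \<Rightarrow>\<^sub>0 'k::field) set" where
  "quandle_relations rhd bul Q Qi H =
     {monomial [Qi a, Q a] - 1 |a. True}
   \<union> {monomial [Q a, Qi a] - 1 |a. True}
   \<union> {monomial [Q a, Q b] - monomial [Q b, Q (rhd b a)] |a b. True}
   \<union> {monomial [H a, H b] - (if a = b then monomial [H a] else 0) |a b. True}
   \<union> {monomial [Q b, H (rhd b a)] - monomial [H a, Q b] |a b. True}
   \<union> {monomial [Q a, Q b] - monomial [Q (bul a b)] |a b. True}"

datatype 'x quandle_gen = QGen 'x | QInvGen 'x | HGen 'x

datatype 'x yb_gen = QuandleGen "'x quandle_gen" | WGen 'x | WInvGen 'x

text \<open>Here \<open>\<sigma> a b\<close> is \<open>\<sigma>\<^sub>a(b)\<close> and \<open>\<tau> b a\<close> is \<open>\<tau>\<^sub>b(a)\<close>.\<close>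

definition yb_relations ::
  "('x \<Rightarrow> 'x \<Rightarrow> 'x) \<Rightarrow> ('x \<Rightarrow> 'x \<Rightarrow> 'x) \<Rightarrow> ('x \<Rightarrow> 'x \<Rightarrow> 'x) \<Rightarrow> ('x \<Rightarrow> 'x \<Rightarrow> 'x)
    \<Rightarrow> ('x yb_gen list \<Rightarrow>\<^sub>0 'k::field) set" where
  "yb_relations rhd bul \<sigma> \<tau> =
   (let Q = \<lambda>a. QuandleGen (QGen a); Qi = \<lambda>a. QuandleGen (QInvGen a);
        H = \<lambda>a. QuandleGen (HGen a); W = WGen; Wi = WInvGen
    in quandle_relations rhd bul Q Qi H
     \<union> {monomial [Wi a, W a] - 1 |a. True}
     \<union> {monomial [W a, Wi a] - 1 |a. True}
     \<union> {monomial [W a, W b] - monomial [W (\<sigma> a b), W (\<tau> b a)] |a b. True}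
     \<union> {monomial [W a, H b] - monomial [H (\<sigma> a b), W a] |a b. True}
     \<union> {monomial [W a, Q b] - monomial [Q (\<sigma> a b), W a] |a b. True})"

definition quandle_algebra ::
  "('k::field \<Rightarrow> 'a::ring_1 \<Rightarrow> 'a) \<Rightarrow> ('x \<Rightarrow> 'x \<Rightarrow> 'x) \<Rightarrow> ('x \<Rightarrow> 'x \<Rightarrow> 'x)
    \<Rightarrow> ('x \<Rightarrow> 'a) \<Rightarrow> ('x \<Rightarrow> 'a) \<Rightarrow> ('x \<Rightarrow> 'a) \<Rightarrow> bool" where
  "quandle_algebra s rhd bul q qi h \<longleftrightarrow>
     (finite (UNIV :: 'x set) \<or> (\<forall>a. surj (rhd a))) \<and>
     (\<forall>a b. bul a b = bul b (rhd b a)) \<and>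
     presented_by s (case_quandle_gen q qi h) HGen (quandle_relations rhd bul QGen QInvGen HGen) \<and>
     (\<forall>a b. h a = h b \<longleftrightarrow> a = b)"

definition yang_baxter_algebra ::
  "('k::field \<Rightarrow> 'a::ring_1 \<Rightarrow> 'a) \<Rightarrow> ('x \<Rightarrow> 'x \<Rightarrow> 'x) \<Rightarrow> ('x \<Rightarrow> 'x \<Rightarrow> 'x)
    \<Rightarrow> ('x \<Rightarrow> 'x \<Rightarrow> 'x) \<Rightarrow> ('x \<Rightarrow> 'x \<Rightarrow> 'x)
    \<Rightarrow> ('x \<Rightarrow> 'a) \<Rightarrow> ('x \<Rightarrow> 'a) \<Rightarrow> ('x \<Rightarrow> 'a) \<Rightarrow> ('x \<Rightarrow> 'a) \<Rightarrow> ('x \<Rightarrow> 'a) \<Rightarrow> bool" where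
  "yang_baxter_algebra s rhd bul \<sigma> \<tau> q qi h w wi \<longleftrightarrow>
     (\<forall>a. bij (\<sigma> a)) \<and>
     presented_by s (case_yb_gen (case_quandle_gen q qi h) w wi) (\<lambda>a. QuandleGen (HGen a))
       (yb_relations rhd bul \<sigma> \<tau>) \<and>
     (\<forall>a b. h a = h b \<longleftrightarrow> a = b)"


section \<open>Tensor powers, with formal sums over the index set\<close>

text \<open>From here on \<open>h\<close> is a family of orthogonal idempotents of an algebra \<open>A\<close> with (formal) sum
  \<open>1\<close>. A tensor is modelled by its values on multilinear forms, with \<open>u \<otimes> v\<close> acting as
  \<open>\<beta> \<mapsto> \<beta> u v\<close>; over a field, the span of these functionals in the dual of the space of
  bilinear forms is the tensor product \<open>A \<otimes> A\<close>.

  Formal sums are admitted by testing only on forms that depend, in every argument, only on finitely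
  many of the components \<open>h\<^sub>a u\<close> of \<open>u = \<Sum>\<^sub>a h\<^sub>a u\<close>: on such a form only finitely many terms of
  \<open>\<Sum>\<^sub>b\<^sub>,\<^sub>c (h\<^sub>b \<otimes> h\<^sub>c) t\<^sub>b\<^sub>c\<close> do not vanish. When the index set is finite every multilinear form qualifies
  (take \<open>F = UNIV\<close> below), and the ordinary tensor powers result. All functionals are
  extended by \<open>0\<close> outside the admitted forms, so that equality of tensors is equality of functions.\<close>

definition linear_form :: "('k::field \<Rightarrow> 'a::ring_1 \<Rightarrow> 'a) \<Rightarrow> ('a \<Rightarrow> 'k) \<Rightarrow> bool" where
  "linear_form s \<phi> \<longleftrightarrow> Vector_Spaces.linear s (*) \<phi>"

definition vanishes_on :: "('x \<Rightarrow> 'a::ring_1) \<Rightarrow> 'x set \<Rightarrow> 'a \<Rightarrow> bool" where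
  "vanishes_on h F u \<longleftrightarrow> (\<forall>a\<in>F. h a * u = 0)"

definition forms1 :: "('k::field \<Rightarrow> 'a::ring_1 \<Rightarrow> 'a) \<Rightarrow> ('x \<Rightarrow> 'a) \<Rightarrow> ('a \<Rightarrow> 'k) set" where
  "forms1 s h = {\<phi>. linear_form s \<phi> \<and>
     (\<exists>F. finite F \<and> (\<forall>u. vanishes_on h F u \<longrightarrow> \<phi> u = 0))}"

definition forms2 :: "('k::field \<Rightarrow> 'a::ring_1 \<Rightarrow> 'a) \<Rightarrow> ('x \<Rightarrow> 'a) \<Rightarrow> ('a \<Rightarrow> 'a \<Rightarrow> 'k) set" where
  "forms2 s h = {\<beta>. (\<forall>v. linear_form s (\<lambda>u. \<beta> u v)) \<and> (\<forall>u. linear_form s (\<lambda>v. \<beta> u v)) \<and>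
     (\<exists>F. finite F \<and> (\<forall>u v. vanishes_on h F u \<or> vanishes_on h F v \<longrightarrow> \<beta> u v = 0))}"

definition forms3 :: "('k::field \<Rightarrow> 'a::ring_1 \<Rightarrow> 'a) \<Rightarrow> ('x \<Rightarrow> 'a) \<Rightarrow> ('a \<Rightarrow> 'a \<Rightarrow> 'a \<Rightarrow> 'k) set" where
  "forms3 s h = {\<gamma>. (\<forall>v w. linear_form s (\<lambda>u. \<gamma> u v w)) \<and> (\<forall>u w. linear_form s (\<lambda>v. \<gamma> u v w)) \<and>
     (\<forall>u v. linear_form s (\<lambda>w. \<gamma> u v w)) \<and>
     (\<exists>F. finite F \<and> (\<forall>u v w. vanishes_on h F u \<or> vanishes_on h F v \<or> vanishes_on h F w
        \<longrightarrow> \<gamma> u v w = 0))}"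

type_synonym ('k, 'a) tensor2 = "('a \<Rightarrow> 'a \<Rightarrow> 'k) \<Rightarrow> 'k"
type_synonym ('k, 'a) tensor3 = "('a \<Rightarrow> 'a \<Rightarrow> 'a \<Rightarrow> 'k) \<Rightarrow> 'k"

definition pure2 ::
  "('k::field \<Rightarrow> 'a::ring_1 \<Rightarrow> 'a) \<Rightarrow> ('x \<Rightarrow> 'a) \<Rightarrow> 'a \<Rightarrow> 'a \<Rightarrow> ('k, 'a) tensor2" where
  "pure2 s h u v = (\<lambda>\<beta>. if \<beta> \<in> forms2 s h then \<beta> u v else 0)"

text \<open>\<^term>\<open>formal_sum I t\<close> is \<open>\<Sum>\<^sub>i\<^sub>\<in>\<^sub>I t\<^sub>i\<close>, for families of tensors such that only finitely many terms
  are nonzero on any given form.\<close>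

definition formal_sum :: "'i set \<Rightarrow> ('i \<Rightarrow> ('k::field, 'a) tensor2) \<Rightarrow> ('k, 'a) tensor2" where
  "formal_sum I t = (\<lambda>\<beta>. \<Sum>i\<in>{i\<in>I. t i \<beta> \<noteq> 0}. t i \<beta>)"

text \<open>The completed tensor square: all formal sums \<open>\<Sum>\<^sub>b\<^sub>,\<^sub>c (h\<^sub>b \<otimes> h\<^sub>c) t\<^sub>b\<^sub>c\<close> of elements
  \<open>t\<^sub>b\<^sub>c = \<Sum>\<^sub>i u\<^sub>i \<otimes> v\<^sub>i\<close> of \<open>A \<otimes> A\<close>.\<close>

definition tensor_square ::
  "('k::field \<Rightarrow> 'a::ring_1 \<Rightarrow> 'a) \<Rightarrow> ('x \<Rightarrow> 'a) \<Rightarrow> ('k, 'a) tensor2 set" where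
  "tensor_square s h =
     {formal_sum UNIV (\<lambda>(b, c) \<beta>. \<Sum>(u, v)\<leftarrow>t b c. pure2 s h (h b * u) (h c * v) \<beta>)
      |t :: 'x \<Rightarrow> 'x \<Rightarrow> ('a \<times> 'a) list. True}"

text \<open>Legwise multiplication: \<open>(u \<otimes> v) (u' \<otimes> v') = u u' \<otimes> v v'\<close>.\<close>

definition mult2 :: "('k::field \<Rightarrow> 'a::ring_1 \<Rightarrow> 'a) \<Rightarrow> ('x \<Rightarrow> 'a)
    \<Rightarrow> ('k, 'a) tensor2 \<Rightarrow> ('k, 'a) tensor2 \<Rightarrow> ('k, 'a) tensor2" where
  "mult2 s h \<Theta> \<Psi> = (\<lambda>\<beta>. if \<beta> \<in> forms2 s h
     then \<Theta> (\<lambda>u v. \<Psi> (\<lambda>u' v'. \<beta> (u * u') (v * v'))) else 0)"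

definition mult3 :: "('k::field \<Rightarrow> 'a::ring_1 \<Rightarrow> 'a) \<Rightarrow> ('x \<Rightarrow> 'a)
    \<Rightarrow> ('k, 'a) tensor3 \<Rightarrow> ('k, 'a) tensor3 \<Rightarrow> ('k, 'a) tensor3" where
  "mult3 s h \<Theta> \<Psi> = (\<lambda>\<gamma>. if \<gamma> \<in> forms3 s h
     then \<Theta> (\<lambda>u v w. \<Psi> (\<lambda>u' v' w'. \<gamma> (u * u') (v * v') (w * w'))) else 0)"

definition flip2 :: "('k::field \<Rightarrow> 'a::ring_1 \<Rightarrow> 'a) \<Rightarrow> ('x \<Rightarrow> 'a)
    \<Rightarrow> ('k, 'a) tensor2 \<Rightarrow> ('k, 'a) tensor2" where
  "flip2 s h \<Theta> = (\<lambda>\<beta>. if \<beta> \<in> forms2 s h then \<Theta> (\<lambda>u v. \<beta> v u) else 0)"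

definition leg12 :: "('k::field \<Rightarrow> 'a::ring_1 \<Rightarrow> 'a) \<Rightarrow> ('x \<Rightarrow> 'a)
    \<Rightarrow> ('k, 'a) tensor2 \<Rightarrow> ('k, 'a) tensor3" where
  "leg12 s h \<Theta> = (\<lambda>\<gamma>. if \<gamma> \<in> forms3 s h then \<Theta> (\<lambda>u v. \<gamma> u v 1) else 0)"

definition leg13 :: "('k::field \<Rightarrow> 'a::ring_1 \<Rightarrow> 'a) \<Rightarrow> ('x \<Rightarrow> 'a)
    \<Rightarrow> ('k, 'a) tensor2 \<Rightarrow> ('k, 'a) tensor3" where
  "leg13 s h \<Theta> = (\<lambda>\<gamma>. if \<gamma> \<in> forms3 s h then \<Theta> (\<lambda>u v. \<gamma> u 1 v) else 0)"

definition leg23 :: "('k::field \<Rightarrow> 'a::ring_1 \<Rightarrow> 'a) \<Rightarrow> ('x \<Rightarrow> 'a)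
    \<Rightarrow> ('k, 'a) tensor2 \<Rightarrow> ('k, 'a) tensor3" where
  "leg23 s h \<Theta> = (\<lambda>\<gamma>. if \<gamma> \<in> forms3 s h then \<Theta> (\<lambda>u v. \<gamma> 1 u v) else 0)"

text \<open>\<open>(\<Delta> \<otimes> id) \<Theta>\<close> and \<open>(id \<otimes> \<Delta>) \<Theta>\<close>; and \<open>(f \<otimes> f) \<Theta>\<close> for \<open>f : A \<rightarrow> B\<close>, where \<open>s\<close> and \<open>h\<close>
  belong to the target \<open>B\<close>.\<close>

definition comult_left :: "('k::field \<Rightarrow> 'a::ring_1 \<Rightarrow> 'a) \<Rightarrow> ('x \<Rightarrow> 'a)
    \<Rightarrow> ('a \<Rightarrow> ('k, 'a) tensor2) \<Rightarrow> ('k, 'a) tensor2 \<Rightarrow> ('k, 'a) tensor3" where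
  "comult_left s h \<Delta> \<Theta> = (\<lambda>\<gamma>. if \<gamma> \<in> forms3 s h
     then \<Theta> (\<lambda>u v. \<Delta> u (\<lambda>u\<^sub>1 u\<^sub>2. \<gamma> u\<^sub>1 u\<^sub>2 v)) else 0)"

definition comult_right :: "('k::field \<Rightarrow> 'a::ring_1 \<Rightarrow> 'a) \<Rightarrow> ('x \<Rightarrow> 'a)
    \<Rightarrow> ('a \<Rightarrow> ('k, 'a) tensor2) \<Rightarrow> ('k, 'a) tensor2 \<Rightarrow> ('k, 'a) tensor3" where
  "comult_right s h \<Delta> \<Theta> = (\<lambda>\<gamma>. if \<gamma> \<in> forms3 s h
     then \<Theta> (\<lambda>u v. \<Delta> v (\<lambda>v\<^sub>1 v\<^sub>2. \<gamma> u v\<^sub>1 v\<^sub>2)) else 0)"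

definition tensor_map :: "('k::field \<Rightarrow> 'b::ring_1 \<Rightarrow> 'b) \<Rightarrow> ('x \<Rightarrow> 'b) \<Rightarrow> ('a \<Rightarrow> 'b)
    \<Rightarrow> ('k, 'a) tensor2 \<Rightarrow> ('k, 'b) tensor2" where
  "tensor_map s h f \<Theta> = (\<lambda>\<beta>. if \<beta> \<in> forms2 s h then \<Theta> (\<lambda>u v. \<beta> (f u) (f v)) else 0)"

text \<open>\<open>f\<close> applied to \<open>\<Theta> = \<Sum>\<^sub>b\<^sub>,\<^sub>c (h\<^sub>b \<otimes> h\<^sub>c) \<Theta>\<close> gives the element \<open>y\<close> of \<open>A\<close>, for a bilinear
  \<open>f : A \<times> A \<rightarrow> A\<close>. The map is applied term by term and the sum over \<open>b, c\<close> is formal. The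
  decomposition is needed since the antipode exchanges left and right multiplication by the \<open>h\<^sub>a\<close>, so
  that \<open>\<lambda>u v. \<phi> (S u * v)\<close> need not lie in \<^const>\<open>forms2\<close> for infinite index sets.\<close>

definition contracts_to :: "('k::field \<Rightarrow> 'a::ring_1 \<Rightarrow> 'a) \<Rightarrow> ('x \<Rightarrow> 'a)
    \<Rightarrow> ('a \<Rightarrow> 'a \<Rightarrow> 'a) \<Rightarrow> ('k, 'a) tensor2 \<Rightarrow> 'a \<Rightarrow> bool" where
  "contracts_to s h f \<Theta> y \<longleftrightarrow> (\<forall>\<phi>\<in>forms1 s h.
     let t = (\<lambda>(b, c). \<Theta> (\<lambda>u v. \<phi> (f (h b * u) (h c * v)))) in
     finite {i. t i \<noteq> 0} \<and> (\<Sum>i\<in>{i. t i \<noteq> 0}. t i) = \<phi> y)"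


section \<open>Quasi-triangular Hopf algebras\<close>

text \<open>An algebra homomorphism into the completed tensor square. The second conjunct is linearity of
  \<open>\<Delta>\<close> together with compatibility with formal sums, so that \<open>\<Delta> \<otimes> id\<close> and \<open>id \<otimes> \<Delta>\<close> make
  sense on formal sums; for a finite index set it is just linearity.\<close>

definition comultiplication :: "('k::field \<Rightarrow> 'a::ring_1 \<Rightarrow> 'a) \<Rightarrow> ('x \<Rightarrow> 'a)
    \<Rightarrow> ('a \<Rightarrow> ('k, 'a) tensor2) \<Rightarrow> bool" where
  "comultiplication s h \<Delta> \<longleftrightarrow>
     range \<Delta> \<subseteq> tensor_square s h \<and>
     (\<forall>\<beta>\<in>forms2 s h. (\<lambda>x. \<Delta> x \<beta>) \<in> forms1 s h) \<and>
     \<Delta> 1 = pure2 s h 1 1 \<and>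
     (\<forall>x y. \<Delta> (x * y) = mult2 s h (\<Delta> x) (\<Delta> y))"

definition hopf_algebra :: "('k::field \<Rightarrow> 'a::ring_1 \<Rightarrow> 'a) \<Rightarrow> ('x \<Rightarrow> 'a)
    \<Rightarrow> ('a \<Rightarrow> ('k, 'a) tensor2) \<Rightarrow> ('a \<Rightarrow> 'k) \<Rightarrow> ('a \<Rightarrow> 'a) \<Rightarrow> bool" where
  "hopf_algebra s h \<Delta> \<epsilon> S \<longleftrightarrow>
     k_algebra s \<and>
     comultiplication s h \<Delta> \<and>
     algebra_hom s (*) \<epsilon> \<and>
     (\<forall>x. comult_left s h \<Delta> (\<Delta> x) = comult_right s h \<Delta> (\<Delta> x)) \<and>
     (\<forall>x. contracts_to s h (\<lambda>u v. s (\<epsilon> u) v) (\<Delta> x) x) \<and>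
     (\<forall>x. contracts_to s h (\<lambda>u v. s (\<epsilon> v) u) (\<Delta> x) x) \<and>
     Vector_Spaces.linear s s S \<and> S 1 = 1 \<and> (\<forall>x y. S (x * y) = S y * S x) \<and>
     (\<forall>x. contracts_to s h (\<lambda>u v. S u * v) (\<Delta> x) (s (\<epsilon> x) 1)) \<and>
     (\<forall>x. contracts_to s h (\<lambda>u v. u * S v) (\<Delta> x) (s (\<epsilon> x) 1))"

definition quasi_triangular :: "('k::field \<Rightarrow> 'a::ring_1 \<Rightarrow> 'a) \<Rightarrow> ('x \<Rightarrow> 'a)
    \<Rightarrow> ('a \<Rightarrow> ('k, 'a) tensor2) \<Rightarrow> ('k, 'a) tensor2 \<Rightarrow> bool" where
  "quasi_triangular s h \<Delta> R \<longleftrightarrow>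
     R \<in> tensor_square s h \<and>
     (\<exists>R'\<in>tensor_square s h. mult2 s h R R' = pure2 s h 1 1 \<and> mult2 s h R' R = pure2 s h 1 1) \<and>
     (\<forall>x. mult2 s h R (\<Delta> x) = mult2 s h (flip2 s h (\<Delta> x)) R) \<and>
     comult_left s h \<Delta> R = mult3 s h (leg13 s h R) (leg23 s h R) \<and>
     comult_right s h \<Delta> R = mult3 s h (leg13 s h R) (leg12 s h R)"

definition rack_R_matrix :: "('k::field \<Rightarrow> 'a::ring_1 \<Rightarrow> 'a) \<Rightarrow> ('x \<Rightarrow> 'a) \<Rightarrow> ('x \<Rightarrow> 'a)
    \<Rightarrow> ('k, 'a) tensor2" where
  "rack_R_matrix s h q = formal_sum UNIV (\<lambda>b. pure2 s h (h b) (q b))"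

end

theory Submission
  imports Defs "HOL-Library.Function_Algebras"
begin

text \<open>Write \<open>B\<close> for the Yang-Baxter algebra. It is generated by the orthogonal idempotents
  \<open>h\<^sub>a\<close>, which sum to \<open>1\<close>, and by the invertible elements \<open>q\<^sub>a\<close>, \<open>w\<^sub>a\<close> and their inverses. Every
  invertible generator \<open>g\<close> permutes the idempotents, \<open>g h\<^sub>b = h\<^sub>c g\<close> with \<open>c = \<pi>(b)\<close>, where
  \<open>\<pi>\<close> is a conjugation of the group \<open>X\<close> or \<open>\<sigma>\<^sub>a\<close> or its inverse. The reason for the theorem is that \<open>\<pi>\<close> is always
  an automorphism of the group \<open>(X, \<bullet>)\<close>: hence conjugation by \<open>g \<otimes> g\<close> maps
  \<open>\<Sum>\<^sub>b\<^sub>c\<^sub>=\<^sub>a h\<^sub>b \<otimes> h\<^sub>c\<close> to the corresponding sum for \<open>\<pi>(a)\<close>, and \<open>\<pi>\<close> fixes \<open>e\<close> and commutes with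
  inversion. So declaring all invertible generators group-like respects the relations.
  The locale \<open>permuted_idempotents\<close> isolates this situation, the Hopf structure is built
  there, and \<open>yang_baxter_permuted_idempotents\<close> exhibits \<open>B\<close> as an instance.

  The algebra is known only through its presentation, which for infinite \<open>X\<close> includes the rule that
  \<open>p\<close> vanishes if all \<open>h\<^sub>a p\<close> do. To define maps on it, let the free algebra act from the right on a
  vector space; if the relations act as zero and the action satisfies that rule, then the whole
  ideal acts as zero (\<open>relation_ideal_annihilates\<close>). Three such modules give the three structure maps.
  The counit comes from the base field. The antipode comes from \<open>B\<close>, a generator acting as left
  multiplication by its intended antipode. The comultiplication comes from the space of admissible
  bilinear forms, where a group-like \<open>g\<close> acts by \<open>\<beta> \<mapsto> \<beta>(g _, g _)\<close>, the idempotent \<open>h\<^sub>a\<close> acts by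
  \<open>\<beta> \<mapsto> \<Sum>\<^sub>b\<^sub>c\<^sub>=\<^sub>a \<beta>(h\<^sub>b _, h\<^sub>c _)\<close>, and \<open>\<Delta>(x)\<close> evaluates \<open>\<beta>\<close> acted upon by \<open>x\<close> at \<open>(1, 1)\<close>.
  The infinitary rule holds on forms because a form is a finite sum of components
  \<open>\<beta>(h\<^sub>b _, h\<^sub>c _)\<close> and each component is fixed by \<open>h\<^sub>b\<^sub>c\<close>; it holds for the antipode because an
  element \<open>x\<close> with \<open>x h\<^sub>a = 0\<close> for all \<open>a\<close> is zero (\<open>zero_if_right_zero\<close>), which rests on the
  local finiteness \<open>vanishes_on_mult\<close>.

  The Hopf axioms are proved by induction along left multiplication by generators
  (\<open>letter_induct\<close>): a group-like generator only translates the forms involved, and an idempotent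
  acts on each component of a form as \<open>0\<close> or \<open>1\<close> (\<open>comult_idempotent\<close>). The same induction over the
  quandle algebra shows that the structure extends the given one. Finally
  \<open>(w\<^sub>a \<otimes> w\<^sub>a) (h\<^sub>b \<otimes> q\<^sub>b) = (h\<^sub>c \<otimes> q\<^sub>c) (w\<^sub>a \<otimes> w\<^sub>a)\<close> with \<open>c = \<sigma>\<^sub>a(b)\<close>, and summing over \<open>b\<close> with
  \<open>\<sigma>\<^sub>a\<close> bijective gives the second claim.\<close>

section \<open>Words and finitely supported functions\<close>

lemma list_unit_and_sum: "(0 :: 'g list) = []" "(u :: 'g list) + v = u @ v"
  by (simp_all add: zero_list_def plus_list_def)

lemma poly_mapping_span_induct [case_names zero add]:
  fixes p :: "'w \<Rightarrow>\<^sub>0 'k::ab_group_add"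
  assumes "P 0" and "\<And>w c p. P p \<Longrightarrow> P (Poly_Mapping.single w c + p)"
  shows "P p"
proof (induction p rule: update_induct)
  case const
  then show ?case using assms(1) by simp
next
  case (update p w c)
  have "Poly_Mapping.update w c p = Poly_Mapping.single w c + p"
    using update(1) by (intro poly_mapping_eqI)
      (auto simp: lookup_add lookup_update lookup_single not_in_keys_iff_lookup_eq_zero when_def)
  with update assms(2) show ?case by simp
qed

section \<open>Right modules over a free algebra\<close>

locale free_algebra_module = vector_space sc
  for sc :: "'k::field \<Rightarrow> 'm::ab_group_add \<Rightarrow> 'm" +
  fixes M :: "'m set" and \<rho> :: "'g \<Rightarrow> 'm \<Rightarrow> 'm"
  assumes M_subspace: "subspace M"
    and letter_closed: "m \<in> M \<Longrightarrow> \<rho> g m \<in> M"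
    and letter_add: "m \<in> M \<Longrightarrow> m' \<in> M \<Longrightarrow> \<rho> g (m + m') = \<rho> g m + \<rho> g m'"
    and letter_scale: "m \<in> M \<Longrightarrow> \<rho> g (sc c m) = sc c (\<rho> g m)"
begin

text \<open>A word acts letter by letter from the left end, so that the action is a right action:
  \<open>p * r\<close> acts by \<open>p\<close> first.\<close>

definition act :: "('g list \<Rightarrow>\<^sub>0 'k) \<Rightarrow> 'm \<Rightarrow> 'm" where
  "act p m = (\<Sum>w\<in>Poly_Mapping.keys p. sc (Poly_Mapping.lookup p w) (fold \<rho> w m))"

lemmas M_closed = subspace_0[OF M_subspace] subspace_add[OF M_subspace] subspace_scale[OF M_subspace]
  subspace_sum[OF M_subspace]

lemma word_closed: "m \<in> M \<Longrightarrow> fold \<rho> w m \<in> M"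
  by (induction w arbitrary: m) (simp_all add: letter_closed)

lemma word_add: "m \<in> M \<Longrightarrow> m' \<in> M \<Longrightarrow> fold \<rho> w (m + m') = fold \<rho> w m + fold \<rho> w m'"
  by (induction w arbitrary: m m') (simp_all add: letter_closed letter_add)

lemma word_scale: "m \<in> M \<Longrightarrow> fold \<rho> w (sc c m) = sc c (fold \<rho> w m)"
  by (induction w arbitrary: m) (simp_all add: letter_closed letter_scale)

lemma act_closed: "m \<in> M \<Longrightarrow> act p m \<in> M"
  unfolding act_def by (intro M_closed word_closed)

lemma act_vector_add: "m \<in> M \<Longrightarrow> m' \<in> M \<Longrightarrow> act p (m + m') = act p m + act p m'"
  unfolding act_def by (simp add: word_add scale_right_distrib sum.distrib)

lemma act_vector_scale: "m \<in> M \<Longrightarrow> act p (sc c m) = sc c (act p m)"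
  unfolding act_def by (simp add: word_scale scale_sum_right mult.commute)

lemma act_vector_zero: "act p 0 = 0"
  using act_vector_scale[of 0 p 0] M_closed(1) by simp

lemma act_vector_sum: "(\<And>i. i \<in> I \<Longrightarrow> f i \<in> M) \<Longrightarrow> act p (sum f I) = (\<Sum>i\<in>I. act p (f i))"
proof (induction I rule: infinite_finite_induct)
  case (insert i I)
  then show ?case by (simp add: act_vector_add M_closed(4))
qed (simp_all add: act_vector_zero)

lemma act_superset:
  "finite K \<Longrightarrow> Poly_Mapping.keys p \<subseteq> K
    \<Longrightarrow> act p m = (\<Sum>w\<in>K. sc (Poly_Mapping.lookup p w) (fold \<rho> w m))"
  unfolding act_def by (rule sum.mono_neutral_left) (auto simp: not_in_keys_iff_lookup_eq_zero)

lemma act_zero: "act 0 m = 0"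
  by (simp add: act_def)

lemma act_single: "act (Poly_Mapping.single w c) m = sc c (fold \<rho> w m)"
  by (subst act_superset[of "{w}"]) (auto split: if_splits)

lemma act_monomial: "act (monomial w) m = fold \<rho> w m"
  by (simp add: monomial_def act_single)

lemma act_one: "act 1 m = m"
proof -
  have "act 1 m = sc 1 (fold \<rho> 0 m)" using act_single[of 0 1 m] unfolding single_one .
  then show ?thesis by (simp add: list_unit_and_sum)
qed

lemma act_add: "act (p + r) m = act p m + act r m"
proof -
  let ?K = "Poly_Mapping.keys p \<union> Poly_Mapping.keys r"
  have "Poly_Mapping.keys (p + r) \<subseteq> ?K" by (rule keys_add)
  then show ?thesis
    by (simp add: act_superset[of ?K] lookup_add scale_left_distrib sum.distrib)
qed

lemma act_minus: "act (- p) m = - act p m"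
  by (rule minus_unique[symmetric]) (simp add: act_add[symmetric] act_zero)

lemma act_diff: "act (p - r) m = act p m - act r m"
  using act_add[of p "- r" m] by (simp add: act_minus)

lemma act_sum: "act (sum f I) m = (\<Sum>i\<in>I. act (f i) m)"
  by (induction I rule: infinite_finite_induct) (simp_all add: act_add act_zero)

lemma act_single_mult:
  assumes "m \<in> M"
  shows "act (Poly_Mapping.single w c * r) m = act r (sc c (fold \<rho> w m))"
proof (induction r rule: poly_mapping_span_induct)
  case zero
  then show ?case by (simp add: act_zero)
next
  case (add v d r)
  then show ?case using assms
    by (simp add: algebra_simps act_add mult_single list_unit_and_sum act_single word_scale word_closed)
qed

lemma act_mult: "m \<in> M \<Longrightarrow> act (p * r) m = act r (act p m)"
proof (induction p rule: poly_mapping_span_induct)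
  case zero
  then show ?case by (simp add: act_zero act_vector_zero)
next
  case (add w c p)
  then show ?case
    by (simp add: distrib_right act_add act_single_mult act_single act_vector_add act_closed
        word_closed M_closed)
qed

text \<open>Elements of the free algebra that act as zero form a two-sided ideal, so only the two rules for
  \<open>\<Sum>\<^sub>a h\<^sub>a = 1\<close> need hypotheses of their own. The infinitary one must be assumed for all \<open>p\<close> at once,
  since the rule is applied to arbitrary members of the ideal.\<close>

lemma relation_ideal_annihilates:
  fixes H :: "'x \<Rightarrow> 'g"
  assumes "\<And>r m. r \<in> Rel \<Longrightarrow> m \<in> M \<Longrightarrow> act r m = 0"
    and "\<And>m. finite (UNIV :: 'x set) \<Longrightarrow> m \<in> M \<Longrightarrow> (\<Sum>a\<in>UNIV. \<rho> (H a) m) = m"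
    and "\<And>p m. infinite (UNIV :: 'x set)
      \<Longrightarrow> (\<And>a m. m \<in> M \<Longrightarrow> act p (\<rho> (H a) m) = 0) \<Longrightarrow> m \<in> M \<Longrightarrow> act p m = 0"
    and "p \<in> relation_ideal H Rel" and "m \<in> M"
  shows "act p m = 0"
  using assms(4,5)
proof (induction arbitrary: m rule: relation_ideal.induct)
  case (relation r)
  then show ?case by (rule assms(1))
next
  case unit_sum
  then show ?case using assms(2) by (simp add: act_diff act_sum act_monomial act_one)
next
  case (formal_unit_sum p)
  have "act p (\<rho> (H a) m') = 0" if "m' \<in> M" for a m'
    using formal_unit_sum.IH[OF that, of a] that by (simp add: act_mult act_monomial)
  with formal_unit_sum(1) show ?case using formal_unit_sum.prems by (rule assms(3))
next
  case (mult_right p r)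
  then show ?case by (simp add: act_mult act_vector_zero)
qed (simp_all add: act_zero act_add act_mult act_closed)

end

section \<open>Algebras presented by generators and relations\<close>

lemma linear_map_iff:
  "Vector_Spaces.linear s s' f \<longleftrightarrow> vector_space s \<and> vector_space s' \<and>
     (\<forall>x y. f (x + y) = f x + f y) \<and> (\<forall>c x. f (s c x) = s' c (f x))"
  by (simp add: module_hom_def module_hom_axioms_def
      flip: module_iff_vector_space module_hom_iff_linear)

text \<open>The regular module \<open>regular\<close> below makes evaluation the action on \<open>1\<close>, from which its
  multiplicativity follows.\<close>

locale presented_algebra =
  fixes s :: "'k::field \<Rightarrow> 'b::ring_1 \<Rightarrow> 'b" and u :: "'g \<Rightarrow> 'b" and H :: "'x \<Rightarrow> 'g"
    and Rel :: "('g list \<Rightarrow>\<^sub>0 'k) set"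
  assumes presented: "presented_by s u H Rel"
begin

sublocale k_algebra s
  using presented by (simp add: presented_by_def)

sublocale regular: free_algebra_module s UNIV "\<lambda>g x. x * u g"
  by unfold_locales (auto simp: algebra_simps scale_mult_left)

lemma fold_regular: "fold (\<lambda>g x. x * u g) w m = m * prod_list (map u w)"
  by (induction w arbitrary: m) (simp_all add: mult.assoc)

lemma evaluate_regular: "regular.act p m = m * evaluate s u p"
  by (simp add: regular.act_def evaluate_def fold_regular sum_distrib_left scale_mult_right)

lemma evaluate_mult: "evaluate s u (p * r) = evaluate s u p * evaluate s u r"
  using regular.act_mult[of 1 p r] by (simp add: evaluate_regular)

lemma evaluate_monomial: "evaluate s u (monomial w) = prod_list (map u w)"
  using regular.act_monomial[of w 1] by (simp add: evaluate_regular fold_regular)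

lemma evaluate_single: "evaluate s u (Poly_Mapping.single w c) = s c (prod_list (map u w))"
  using regular.act_single[of w c 1] by (simp add: evaluate_regular fold_regular)

lemma evaluate_one: "evaluate s u 1 = 1"
  using regular.act_one[of 1] by (simp add: evaluate_regular)

lemma evaluate_add: "evaluate s u (p + r) = evaluate s u p + evaluate s u r"
  using regular.act_add[of p r 1] by (simp add: evaluate_regular)

lemma evaluate_diff: "evaluate s u (p - r) = evaluate s u p - evaluate s u r"
  using regular.act_diff[of p r 1] by (simp add: evaluate_regular)

lemma evaluate_zero: "evaluate s u 0 = 0"
  using regular.act_zero[of 1] by (simp add: evaluate_regular)

lemma evaluate_sum: "evaluate s u (sum f I) = (\<Sum>i\<in>I. evaluate s u (f i))"
  using regular.act_sum[of f I 1] by (simp add: evaluate_regular)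

lemma evaluate_surj: obtains p where "evaluate s u p = x"
  using presented by (metis presented_by_def surjD)

lemma evaluate_eq_0_iff: "evaluate s u p = 0 \<longleftrightarrow> p \<in> relation_ideal H Rel"
  using presented by (auto simp: presented_by_def)

lemma relation_equation:
  assumes "monomial v - monomial w \<in> Rel"
  shows "prod_list (map u v) = prod_list (map u w)"
proof -
  have "evaluate s u (monomial v - monomial w) = 0"
    using assms by (simp add: evaluate_eq_0_iff relation_ideal.relation)
  then show ?thesis by (simp add: evaluate_diff evaluate_monomial)
qed

lemma sum_unit: "finite (UNIV :: 'x set) \<Longrightarrow> (\<Sum>a\<in>UNIV. u (H a)) = 1"
  using evaluate_eq_0_iff relation_ideal.unit_sum[of H Rel]
  by (force simp: evaluate_diff evaluate_sum evaluate_monomial evaluate_one)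

text \<open>For infinite index sets this is what the rule for formal sums adds to the ideal.\<close>

lemma zero_if_vanishes_everywhere:
  assumes "\<And>a. u (H a) * x = 0"
  shows "x = 0"
proof (cases "finite (UNIV :: 'x set)")
  case True
  have "x = (\<Sum>a\<in>UNIV. u (H a)) * x" using sum_unit[OF True] by simp
  also have "\<dots> = 0" using assms by (simp add: sum_distrib_right)
  finally show ?thesis .
next
  case False
  obtain p where p: "evaluate s u p = x" by (rule evaluate_surj)
  have "monomial [H a] * p \<in> relation_ideal H Rel" for a
    using assms p by (simp add: evaluate_eq_0_iff[symmetric] evaluate_mult evaluate_monomial)
  with False have "p \<in> relation_ideal H Rel" by (rule relation_ideal.formal_unit_sum)
  with p show ?thesis by (simp add: evaluate_eq_0_iff[symmetric])
qed

text \<open>Multiplicativity of a property is required only for left multiplication by a generator: the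
  products of generators span the algebra and are built up from the right.\<close>

lemma generators_induct [case_names one add scale letter]:
  assumes "P 1" and "\<And>x y. P x \<Longrightarrow> P y \<Longrightarrow> P (x + y)" and "\<And>c x. P x \<Longrightarrow> P (s c x)"
    and "\<And>g x. P x \<Longrightarrow> P (u g * x)"
  shows "P x"
proof -
  obtain p where p: "x = evaluate s u p" using evaluate_surj by metis
  have word: "P (prod_list (map u w))" for w
    by (induction w) (simp_all add: assms)
  have "P (evaluate s u p)"
  proof (induction p rule: poly_mapping_span_induct)
    case zero
    show ?case using assms(3)[of 1 0] assms(1) by (simp add: evaluate_zero)
  next
    case (add w c p)
    then show ?case by (simp add: evaluate_add evaluate_single assms word)
  qed
  with p show ?thesis by simp
qed

end

text \<open>A module killed by the ideal becomes a right module \<open>rep\<close> over the presented algebra; the choice of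
  a preimage in the definition of \<open>rep\<close> is immaterial by \<open>rep_evaluate\<close>.\<close>

locale presented_module = presented_algebra s u H Rel + right: free_algebra_module sc M \<rho>
  for s :: "'k::field \<Rightarrow> 'b::ring_1 \<Rightarrow> 'b" and u :: "'g \<Rightarrow> 'b" and H :: "'x \<Rightarrow> 'g"
    and Rel :: "('g list \<Rightarrow>\<^sub>0 'k) set"
    and sc :: "'k \<Rightarrow> 'm::ab_group_add \<Rightarrow> 'm" and M :: "'m set" and \<rho> :: "'g \<Rightarrow> 'm \<Rightarrow> 'm" +
  assumes ideal_annihilates: "p \<in> relation_ideal H Rel \<Longrightarrow> m \<in> M \<Longrightarrow> right.act p m = 0"
begin

definition rep :: "'b \<Rightarrow> 'm \<Rightarrow> 'm" where
  "rep x m = right.act (SOME p. evaluate s u p = x) m"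

lemma rep_evaluate:
  assumes "m \<in> M"
  shows "rep (evaluate s u p) m = right.act p m"
proof -
  let ?p = "SOME p'. evaluate s u p' = evaluate s u p"
  have "evaluate s u ?p = evaluate s u p" by (rule someI) (rule refl)
  then have "?p - p \<in> relation_ideal H Rel"
    by (simp add: evaluate_eq_0_iff[symmetric] evaluate_diff)
  with assms have "right.act (?p - p) m = 0" by (intro ideal_annihilates)
  then show ?thesis by (simp add: rep_def right.act_diff)
qed

lemma rep_one: "m \<in> M \<Longrightarrow> rep 1 m = m"
  using rep_evaluate[of m 1] by (simp add: evaluate_one right.act_one)

lemma rep_add: "m \<in> M \<Longrightarrow> rep (x + y) m = rep x m + rep y m"
proof -
  assume m: "m \<in> M"
  obtain p r where "x = evaluate s u p" "y = evaluate s u r" using evaluate_surj by metis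
  with m show ?thesis by (simp add: evaluate_add[symmetric] rep_evaluate right.act_add)
qed

lemma rep_scale:
  assumes m: "m \<in> M"
  shows "rep (s c x) m = sc c (rep x m)"
proof -
  obtain p where p: "x = evaluate s u p" using evaluate_surj by metis
  have "evaluate s u (Poly_Mapping.single [] c * p) = s c x"
    by (simp add: evaluate_mult evaluate_single scale_mult_left p)
  with rep_evaluate[OF m, of "Poly_Mapping.single [] c * p"] m show ?thesis
    by (simp add: right.act_single_mult right.act_vector_scale rep_evaluate p)
qed

lemma rep_letter: "m \<in> M \<Longrightarrow> rep (u g * x) m = rep x (\<rho> g m)"
proof -
  assume m: "m \<in> M"
  obtain p where p: "x = evaluate s u p" using evaluate_surj by metis
  have "evaluate s u (monomial [g] * p) = u g * x"
    by (simp add: evaluate_mult evaluate_monomial p)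
  with rep_evaluate[OF m, of "monomial [g] * p"] m show ?thesis
    by (simp add: right.act_mult right.act_monomial rep_evaluate p right.letter_closed)
qed

lemma rep_vector_add: "m \<in> M \<Longrightarrow> m' \<in> M \<Longrightarrow> rep x (m + m') = rep x m + rep x m'"
  by (simp add: rep_def right.act_vector_add)

lemma rep_vector_scale: "m \<in> M \<Longrightarrow> rep x (sc c m) = sc c (rep x m)"
  by (simp add: rep_def right.act_vector_scale)

lemma rep_vector_zero: "rep x 0 = 0"
  by (simp add: rep_def right.act_vector_zero)

lemma rep_vector_sum: "(\<And>i. i \<in> I \<Longrightarrow> f i \<in> M) \<Longrightarrow> rep x (sum f I) = (\<Sum>i\<in>I. rep x (f i))"
  by (simp add: rep_def right.act_vector_sum)

end

section \<open>Forms\<close>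

lemma vector_space_mult: "vector_space ((*) :: 'k::field \<Rightarrow> 'k \<Rightarrow> 'k)"
  by unfold_locales (simp_all add: algebra_simps)

lemma module_mult: "module ((*) :: 'k::field \<Rightarrow> 'k \<Rightarrow> 'k)"
  by (simp add: module_iff_vector_space vector_space_mult)

lemma vanishes_on_mono: "F \<subseteq> F' \<Longrightarrow> vanishes_on h F' x \<Longrightarrow> vanishes_on h F x"
  by (auto simp: vanishes_on_def)

definition supports2 :: "('x \<Rightarrow> 'a::ring_1) \<Rightarrow> 'x set \<Rightarrow> ('a \<Rightarrow> 'a \<Rightarrow> 'k::zero) \<Rightarrow> bool" where
  "supports2 h F \<beta> \<longleftrightarrow> (\<forall>x y. vanishes_on h F x \<or> vanishes_on h F y \<longrightarrow> \<beta> x y = 0)"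

text \<open>The action of \<open>x \<otimes> y\<close> on forms that is dual to left multiplication.\<close>

definition shift :: "'a::times \<Rightarrow> 'a \<Rightarrow> ('a \<Rightarrow> 'a \<Rightarrow> 'k) \<Rightarrow> 'a \<Rightarrow> 'a \<Rightarrow> 'k" where
  "shift x y \<beta> = (\<lambda>x' y'. \<beta> (x * x') (y * y'))"

definition form_scale :: "'k::times \<Rightarrow> ('a \<Rightarrow> 'a \<Rightarrow> 'k) \<Rightarrow> 'a \<Rightarrow> 'a \<Rightarrow> 'k" where
  "form_scale c \<beta> = (\<lambda>x y. c * \<beta> x y)"

interpretation form_space: vector_space "form_scale :: 'k::field \<Rightarrow> ('a \<Rightarrow> 'a \<Rightarrow> 'k) \<Rightarrow> _"
  by unfold_locales (simp_all add: form_scale_def fun_eq_iff algebra_simps)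

lemma sum_fun_apply: "sum f I x = (\<Sum>i\<in>I. f i x)"
  by (induction I rule: infinite_finite_induct) simp_all

lemma supports2_mono: "F \<subseteq> F' \<Longrightarrow> supports2 h F \<beta> \<Longrightarrow> supports2 h F' \<beta>"
  unfolding supports2_def using vanishes_on_mono by blast

context k_algebra
begin

lemma linear_form_iff:
  "linear_form scale \<phi> \<longleftrightarrow> (\<forall>x y. \<phi> (x + y) = \<phi> x + \<phi> y) \<and> (\<forall>c x. \<phi> (scale c x) = c * \<phi> x)"
  by (simp add: linear_form_def linear_map_iff vector_space_mult vector_space_axioms)

lemma linear_form_simps:
  assumes "linear_form scale \<phi>"
  shows "\<phi> (x + y) = \<phi> x + \<phi> y" "\<phi> (scale c x) = c * \<phi> x" "\<phi> 0 = 0" "\<phi> (x - y) = \<phi> x - \<phi> y"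
    "\<phi> (sum f I) = (\<Sum>i\<in>I. \<phi> (f i))"
proof -
  interpret Vector_Spaces.linear scale "(*)" \<phi>
    using assms by (simp add: linear_form_def)
  show "\<phi> (x + y) = \<phi> x + \<phi> y" "\<phi> (scale c x) = c * \<phi> x" "\<phi> 0 = 0" "\<phi> (x - y) = \<phi> x - \<phi> y"
    "\<phi> (sum f I) = (\<Sum>i\<in>I. \<phi> (f i))"
    by (simp_all add: add scale zero diff sum)
qed

lemma forms2_iff:
  "\<beta> \<in> forms2 scale h \<longleftrightarrow> (\<forall>y. linear_form scale (\<lambda>x. \<beta> x y)) \<and> (\<forall>x. linear_form scale (\<beta> x))
    \<and> (\<exists>F. finite F \<and> supports2 h F \<beta>)"
  by (simp add: forms2_def supports2_def)

lemma forms2_linear: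
  assumes "\<beta> \<in> forms2 scale h"
  shows "linear_form scale (\<lambda>x. \<beta> x y)" "linear_form scale (\<beta> x)"
  using assms by (simp_all add: forms2_iff)

lemma forms2_support:
  assumes "\<beta> \<in> forms2 scale h"
  obtains F where "finite F" "supports2 h F \<beta>"
  using assms by (auto simp: forms2_iff)

lemma forms2I:
  assumes "\<And>x x' y. \<beta> (x + x') y = \<beta> x y + \<beta> x' y" "\<And>c x y. \<beta> (scale c x) y = c * \<beta> x y"
    "\<And>x y y'. \<beta> x (y + y') = \<beta> x y + \<beta> x y'" "\<And>c x y. \<beta> x (scale c y) = c * \<beta> x y"
    "finite F" "supports2 h F \<beta>"
  shows "\<beta> \<in> forms2 scale h"
  using assms by (auto simp: forms2_iff linear_form_iff)

lemma forms2_simps: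
  assumes "\<beta> \<in> forms2 scale h"
  shows "\<beta> (x + x') y = \<beta> x y + \<beta> x' y" "\<beta> (scale c x) y = c * \<beta> x y"
    "\<beta> x (y + y') = \<beta> x y + \<beta> x y'" "\<beta> x (scale c y) = c * \<beta> x y"
    "\<beta> 0 y = 0" "\<beta> x 0 = 0" "\<beta> (sum f I) y = (\<Sum>i\<in>I. \<beta> (f i) y)"
    "\<beta> x (sum f I) = (\<Sum>i\<in>I. \<beta> x (f i))"
  using linear_form_simps[OF forms2_linear(1)[OF assms]] linear_form_simps[OF forms2_linear(2)[OF assms]]
  by simp_all

lemma forms2_subspace: "form_space.subspace (forms2 scale h)"
proof (rule form_space.subspaceI)
  show "0 \<in> forms2 scale h"
    by (rule forms2I[of _ "{}"]) (simp_all add: supports2_def)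
next
  fix \<beta> \<beta>' assume *: "\<beta> \<in> forms2 scale h" "\<beta>' \<in> forms2 scale h"
  obtain F where F: "finite F" "supports2 h F \<beta>" using *(1) by (rule forms2_support)
  obtain F' where F': "finite F'" "supports2 h F' \<beta>'" using *(2) by (rule forms2_support)
  have "supports2 h (F \<union> F') \<beta>" "supports2 h (F \<union> F') \<beta>'"
    using F F' by (auto intro: supports2_mono[rotated])
  then have "supports2 h (F \<union> F') (\<beta> + \<beta>')" by (simp add: supports2_def)
  then show "\<beta> + \<beta>' \<in> forms2 scale h"
    using F F' * by (intro forms2I[of _ "F \<union> F'"]) (simp_all add: forms2_simps algebra_simps)
next
  fix c \<beta> assume *: "\<beta> \<in> forms2 scale h"
  obtain F where F: "finite F" "supports2 h F \<beta>" using * by (rule forms2_support)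
  then show "form_scale c \<beta> \<in> forms2 scale h"
    using * by (intro forms2I[of _ F])
      (simp_all add: forms2_simps form_scale_def supports2_def algebra_simps)
qed

lemma forms1_iff:
  "\<phi> \<in> forms1 scale h \<longleftrightarrow> linear_form scale \<phi>
     \<and> (\<exists>F. finite F \<and> (\<forall>x. vanishes_on h F x \<longrightarrow> \<phi> x = 0))"
  by (simp add: forms1_def)

end

section \<open>Idempotents permuted by invertible generators\<close>

locale permuted_idempotents =
  presented_algebra s gen H Rel + X: group bul e star
  for s :: "'k::field \<Rightarrow> 'b::ring_1 \<Rightarrow> 'b" and gen :: "'g \<Rightarrow> 'b" and H :: "'x \<Rightarrow> 'g"
    and Rel :: "('g list \<Rightarrow>\<^sub>0 'k) set"
    and bul :: "'x \<Rightarrow> 'x \<Rightarrow> 'x" and e :: 'x and star :: "'x \<Rightarrow> 'x" +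
  fixes h :: "'x \<Rightarrow> 'b" and L :: "'g set" and inv_gen :: "'g \<Rightarrow> 'b" and \<pi> :: "'g \<Rightarrow> 'x \<Rightarrow> 'x"
  \<comment> \<open>The letters in \<open>L\<close> stand for the invertible generators. Relations between words in these letters
    may be arbitrary: both sides will be group-like, with the same value.\<close>
  assumes inj_H: "inj H" and letters: "L = - range H" and gen_H: "gen (H a) = h a"
    and orthogonal: "h a * h b = (if a = b then h a else 0)"
    and gen_inv: "g \<in> L \<Longrightarrow> gen g * inv_gen g = 1" and inv_gen: "g \<in> L \<Longrightarrow> inv_gen g * gen g = 1"
    and bij_\<pi>: "g \<in> L \<Longrightarrow> bij (\<pi> g)"
    and \<pi>_hom: "g \<in> L \<Longrightarrow> \<pi> g (bul a b) = bul (\<pi> g a) (\<pi> g b)"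
    and gen_h: "g \<in> L \<Longrightarrow> gen g * h b = h (\<pi> g b) * gen g"
    and relation_cases: "r \<in> Rel \<Longrightarrow>
      (\<exists>v w. set v \<subseteq> L \<and> set w \<subseteq> L \<and> r = monomial v - monomial w) \<or>
      (\<exists>a b. r = monomial [H a, H b] - (if a = b then monomial [H a] else 0)) \<or>
      (\<exists>g b. g \<in> L \<and> r = monomial [g, H b] - monomial [H (\<pi> g b), g])"
begin

subsection \<open>Idempotents and supports\<close>

lemma H_notin_L [simp]: "H a \<notin> L"
  by (simp add: letters)

lemma letter_cases: obtains "g \<in> L" | a where "g = H a"
  using letters by blast

lemma bul_eq_iff: "bul a b = c \<longleftrightarrow> b = bul (star a) c"
  by (metis X.assoc X.left_inverse X.right_inverse X.left_neutral)

lemma star_eq_iff: "star a = star b \<longleftrightarrow> a = b"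
  by (metis X.inverse_inverse)

lemma \<pi>_eq_iff: "g \<in> L \<Longrightarrow> \<pi> g a = \<pi> g b \<longleftrightarrow> a = b"
  using bij_\<pi> by (auto simp: bij_def inj_eq)

lemma \<pi>_surj: "g \<in> L \<Longrightarrow> (\<And>a. b = \<pi> g a \<Longrightarrow> thesis) \<Longrightarrow> thesis"
  using bij_\<pi> by (metis bij_pointE)

lemma \<pi>_e: "g \<in> L \<Longrightarrow> \<pi> g e = e"
  using \<pi>_hom[of g e e] by (metis X.left_cancel X.left_neutral X.right_neutral)

lemma \<pi>_star: "g \<in> L \<Longrightarrow> \<pi> g (star a) = star (\<pi> g a)"
  using \<pi>_hom[of g a "star a"] \<pi>_e by (metis X.inverse_unique X.right_inverse)

lemma h_h: "h a * (h b * x) = (if a = b then h a * x else 0)"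
  using orthogonal[of a b] by (simp add: mult.assoc[symmetric])

lemma gen_h_left: "g \<in> L \<Longrightarrow> gen g * (h b * x) = h (\<pi> g b) * (gen g * x)"
  using gen_h[of g b] by (simp add: mult.assoc[symmetric])

lemma inv_gen_h:
  assumes g: "g \<in> L"
  shows "h b * inv_gen g = inv_gen g * h (\<pi> g b)"
proof -
  have "inv_gen g * (gen g * h b) * inv_gen g = inv_gen g * (h (\<pi> g b) * gen g) * inv_gen g"
    using g by (simp add: gen_h)
  then show ?thesis
    using g by (simp add: mult.assoc gen_inv) (simp add: mult.assoc[symmetric] inv_gen)
qed

lemma vanishes_on_remainder:
  assumes "finite F"
  shows "vanishes_on h F (x - (\<Sum>b\<in>F. h b * x))"
  using assms by (simp add: vanishes_on_def right_diff_distrib sum_distrib_left h_h)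

lemma zero_if_left_zero: "(\<And>a. h a * x = 0) \<Longrightarrow> x = 0"
  by (rule zero_if_vanishes_everywhere) (simp add: gen_H)

text \<open>Local finiteness: \<open>h\<^sub>b x\<close> meets only finitely many \<open>h\<^sub>a\<close> on its right. A group-like generator
  replaces \<open>b\<close> by a single index and an idempotent keeps or kills it.\<close>

lemma vanishes_on_mult:
  assumes "finite F"
  obtains F' where "finite F'" "\<And>z. vanishes_on h F' z \<Longrightarrow> vanishes_on h F (x * z)"
proof -
  have *: "\<exists>F'. finite F' \<and> (\<forall>z. vanishes_on h F' z \<longrightarrow> h b * (x * z) = 0)" for b
  proof (induction x arbitrary: b rule: generators_induct)
    case one
    show ?case by (rule exI[of _ "{b}"]) (simp add: vanishes_on_def)
  next
    case (add x y)
    from add.IH obtain F1 F2 where "finite F1" "\<forall>z. vanishes_on h F1 z \<longrightarrow> h b * (x * z) = 0"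
      "finite F2" "\<forall>z. vanishes_on h F2 z \<longrightarrow> h b * (y * z) = 0" by metis
    then show ?case
      by (intro exI[of _ "F1 \<union> F2"]) (auto simp: algebra_simps vanishes_on_def)
  next
    case (scale c x)
    then show ?case by (simp add: scale_mult_left scale_mult_right) (metis scale_zero_right)
  next
    case (letter g x)
    show ?case
    proof (cases g rule: letter_cases)
      case 1
      obtain b' where "b = \<pi> g b'" using \<pi>_surj[OF 1] .
      with 1 letter.IH[of b'] show ?thesis
        by (metis gen_h_left mult.assoc mult_zero_right)
    next
      case (2 a)
      with letter.IH[of b] show ?thesis
        by (cases "a = b") (auto simp: gen_H mult.assoc h_h)
    qed
  qed
  then obtain F' where F': "\<And>b. finite (F' b)" "\<And>b z. vanishes_on h (F' b) z \<Longrightarrow> h b * (x * z) = 0"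
    by metis
  show thesis
  proof (rule that[of "\<Union>b\<in>F. F' b"])
    show "finite (\<Union>b\<in>F. F' b)" using assms F'(1) by simp
    show "vanishes_on h F (x * z)" if "vanishes_on h (\<Union>b\<in>F. F' b) z" for z
      using that unfolding vanishes_on_def by (metis F'(2) UN_I vanishes_on_def)
  qed
qed

text \<open>By local finiteness \<open>h\<^sub>b x\<close> is the sum of finitely many \<open>h\<^sub>b x h\<^sub>a\<close>, so vanishing on the right
  implies vanishing on the left.\<close>

lemma zero_if_right_zero:
  assumes "\<And>a. x * h a = 0"
  shows "x = 0"
proof (rule zero_if_left_zero)
  fix b
  obtain F where F: "finite F" "\<And>z. vanishes_on h F z \<Longrightarrow> vanishes_on h {b} (x * z)"
    by (rule vanishes_on_mult[of "{b}" x]) auto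
  have "x * (1 - (\<Sum>a\<in>F. h a)) = x"
    using assms by (simp add: right_diff_distrib sum_distrib_left)
  with F(2)[OF vanishes_on_remainder[OF F(1), of 1]] show "h b * x = 0"
    by (simp add: vanishes_on_def)
qed

lemma supports2_expand:
  assumes "\<beta> \<in> forms2 s h" "finite F" "supports2 h F \<beta>"
  shows "\<beta> x y = (\<Sum>b\<in>F. \<Sum>c\<in>F. \<beta> (h b * x) (h c * y))"
proof -
  have "\<beta> (x - (\<Sum>b\<in>F. h b * x)) y = 0" for x y
    using assms vanishes_on_remainder by (auto simp: supports2_def)
  then have *: "\<beta> x y = (\<Sum>b\<in>F. \<beta> (h b * x) y)" for x y
    using linear_form_simps(4)[OF forms2_linear(1)[OF assms(1), of y], of x "\<Sum>b\<in>F. h b * x"]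
    by (simp add: forms2_simps[OF assms(1)])
  have "\<beta> x (y - (\<Sum>b\<in>F. h b * y)) = 0" for x y
    using assms vanishes_on_remainder by (auto simp: supports2_def)
  then have **: "\<beta> x y = (\<Sum>b\<in>F. \<beta> x (h b * y))" for x y
    using linear_form_simps(4)[OF forms2_linear(2)[OF assms(1), of x], of y "\<Sum>b\<in>F. h b * y"]
    by (simp add: forms2_simps[OF assms(1)])
  show ?thesis by (subst *, subst **) (rule refl)
qed

lemma shift_forms2:
  assumes "\<beta> \<in> forms2 s h"
  shows "shift x y \<beta> \<in> forms2 s h"
proof -
  obtain F where F: "finite F" "supports2 h F \<beta>" using assms by (rule forms2_support)
  obtain F1 where F1: "finite F1" "\<And>z. vanishes_on h F1 z \<Longrightarrow> vanishes_on h F (x * z)"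
    using vanishes_on_mult[OF F(1), of x] by blast
  obtain F2 where F2: "finite F2" "\<And>z. vanishes_on h F2 z \<Longrightarrow> vanishes_on h F (y * z)"
    using vanishes_on_mult[OF F(1), of y] by blast
  show ?thesis
  proof (rule forms2I[of _ "F1 \<union> F2"])
    have "vanishes_on h F (x * z)" "vanishes_on h F (y * z)" if "vanishes_on h (F1 \<union> F2) z" for z
      using that F1(2) F2(2) vanishes_on_mono[of _ "F1 \<union> F2" h z] by auto
    then show "supports2 h (F1 \<union> F2) (shift x y \<beta>)"
      using F(2) by (auto simp: shift_def supports2_def)
  qed (use assms F1(1) F2(1) in \<open>simp_all add: shift_def distrib_left scale_mult_right forms2_simps\<close>)
qed

text \<open>The action of \<open>\<Sum>\<^sub>b\<^sub>c\<^sub>=\<^sub>a h\<^sub>b \<otimes> h\<^sub>c\<close> on forms. The index \<open>c\<close> is determined by \<open>b\<close>, which makes it a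
  sum over \<open>b\<close> alone; it is finite on every form with finite support.\<close>

definition decompose :: "'x \<Rightarrow> ('b \<Rightarrow> 'b \<Rightarrow> 'k) \<Rightarrow> 'b \<Rightarrow> 'b \<Rightarrow> 'k" where
  "decompose a \<beta> = (\<lambda>x y. Sum_any (\<lambda>b. \<beta> (h b * x) (h (bul (star b) a) * y)))"

lemma decompose_superset:
  assumes "finite F" and "\<And>b. b \<notin> F \<Longrightarrow> \<beta> (h b * x) (h (bul (star b) a) * y) = 0"
  shows "decompose a \<beta> x y = (\<Sum>b\<in>F. \<beta> (h b * x) (h (bul (star b) a) * y))"
  unfolding decompose_def using assms by (intro Sum_any.expand_superset) auto

lemma supports2_outside:
  assumes "supports2 h F \<beta>" "b \<notin> F"
  shows "\<beta> (h b * x) y = 0" "\<beta> x (h b * y) = 0"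
proof -
  have "vanishes_on h F (h b * z)" for z using assms(2) by (auto simp: vanishes_on_def h_h)
  with assms(1) show "\<beta> (h b * x) y = 0" "\<beta> x (h b * y) = 0" by (auto simp: supports2_def)
qed

lemma decompose_eq:
  assumes "finite F" "supports2 h F \<beta>"
  shows "decompose a \<beta> x y = (\<Sum>b\<in>F. \<beta> (h b * x) (h (bul (star b) a) * y))"
  using assms by (intro decompose_superset) (simp_all add: supports2_outside)

lemma supports2_decompose:
  assumes "finite F" "\<beta> \<in> forms2 s h" "supports2 h F \<beta>"
  shows "supports2 h F (decompose a \<beta>)"
proof -
  have "\<beta> (h b * x) (h c * y) = 0" if "vanishes_on h F x \<or> vanishes_on h F y" for b c x y
  proof (cases "b \<in> F \<and> c \<in> F")
    case True
    with that show ?thesis using assms(2) by (auto simp: vanishes_on_def forms2_simps)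
  qed (use supports2_outside[OF assms(3)] in auto)
  then show ?thesis using assms by (auto simp: supports2_def decompose_def)
qed

lemma decompose_add:
  assumes "\<beta> \<in> forms2 s h" "\<beta>' \<in> forms2 s h"
  shows "decompose a (\<beta> + \<beta>') = decompose a \<beta> + decompose a \<beta>'"
proof -
  obtain F where F: "finite F" "supports2 h F \<beta>" using assms(1) by (rule forms2_support)
  obtain F' where F': "finite F'" "supports2 h F' \<beta>'" using assms(2) by (rule forms2_support)
  have "finite (F \<union> F')" "supports2 h (F \<union> F') \<beta>" "supports2 h (F \<union> F') \<beta>'"
    using F F' by (auto intro: supports2_mono[rotated])
  moreover from this have "supports2 h (F \<union> F') (\<beta> + \<beta>')" by (simp add: supports2_def)
  ultimately show ?thesis
    by (simp add: fun_eq_iff decompose_eq[of "F \<union> F'"] sum.distrib)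
qed

lemma decompose_scale:
  assumes "\<beta> \<in> forms2 s h"
  shows "decompose a (form_scale c \<beta>) = form_scale c (decompose a \<beta>)"
proof -
  obtain F where F: "finite F" "supports2 h F \<beta>" using assms(1) by (rule forms2_support)
  then have "supports2 h F (form_scale c \<beta>)" by (simp add: supports2_def form_scale_def)
  with F show ?thesis
    by (simp add: fun_eq_iff decompose_eq[of F] form_scale_def sum_distrib_left)
qed

lemma decompose_forms2:
  assumes "\<beta> \<in> forms2 s h"
  shows "decompose a \<beta> \<in> forms2 s h"
proof -
  obtain F where F: "finite F" "supports2 h F \<beta>" using assms by (rule forms2_support)
  show ?thesis
    using assms F by (intro forms2I[of _ F])
     (simp_all add: decompose_eq[OF F] supports2_decompose forms2_simps distrib_left scale_mult_right
       sum.distrib sum_distrib_left)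
qed

text \<open>A component of a form is an eigenvector of every \<open>h\<^sub>a\<close>, with eigenvalue \<open>0\<close> or \<open>1\<close>.\<close>

lemma decompose_shift:
  assumes "\<beta> \<in> forms2 s h"
  shows "decompose a (shift (h b) (h c) \<beta>) = (if bul b c = a then shift (h b) (h c) \<beta> else 0)"
proof (intro ext)
  fix x y
  have "decompose a (shift (h b) (h c) \<beta>) x y
    = (\<Sum>d\<in>{b}. shift (h b) (h c) \<beta> (h d * x) (h (bul (star d) a) * y))"
    using assms by (intro decompose_superset) (simp_all add: shift_def h_h forms2_simps)
  then show "decompose a (shift (h b) (h c) \<beta>) x y
    = (if bul b c = a then shift (h b) (h c) \<beta> else 0) x y"
    using assms by (simp add: shift_def h_h forms2_simps bul_eq_iff[of b c a])
qed

lemma shift_expand: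
  assumes "\<beta> \<in> forms2 s h" "finite F" "supports2 h F \<beta>"
  shows "\<beta> = (\<Sum>(b, c)\<in>F \<times> F. shift (h b) (h c) \<beta>)"
proof (intro ext)
  fix x y
  show "\<beta> x y = (\<Sum>(b, c)\<in>F \<times> F. shift (h b) (h c) \<beta>) x y"
    by (subst supports2_expand[OF assms])
      (simp add: sum_fun_apply shift_def sum.cartesian_product case_prod_unfold)
qed

subsection \<open>The three modules\<close>

definition index :: "'g \<Rightarrow> 'x" where "index = inv H"

lemma index_H [simp]: "index (H a) = a"
  by (simp add: index_def inj_H)

definition counit_letter :: "'g \<Rightarrow> 'k" where
  "counit_letter g = (if g \<in> L \<or> index g = e then 1 else 0)"

definition antipode_letter :: "'g \<Rightarrow> 'b" where
  "antipode_letter g = (if g \<in> L then inv_gen g else h (star (index g)))"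

definition comult_letter :: "'g \<Rightarrow> ('b \<Rightarrow> 'b \<Rightarrow> 'k) \<Rightarrow> 'b \<Rightarrow> 'b \<Rightarrow> 'k" where
  "comult_letter g \<beta> = (if g \<in> L then shift (gen g) (gen g) \<beta> else decompose (index g) \<beta>)"

lemma letter_simps [simp]:
  "g \<in> L \<Longrightarrow> counit_letter g = 1" "counit_letter (H a) = (if a = e then 1 else 0)"
  "g \<in> L \<Longrightarrow> antipode_letter g = inv_gen g" "antipode_letter (H a) = h (star a)"
  "g \<in> L \<Longrightarrow> comult_letter g = shift (gen g) (gen g)" "comult_letter (H a) = decompose a"
  by (simp_all add: counit_letter_def antipode_letter_def comult_letter_def fun_eq_iff)

lemma relation_induct [consumes 1, case_names words orthogonal permute]:
  assumes "r \<in> Rel"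
    and "\<And>v w. set v \<subseteq> L \<Longrightarrow> set w \<subseteq> L \<Longrightarrow> prod_list (map gen v) = prod_list (map gen w)
      \<Longrightarrow> P (monomial v - monomial w)"
    and "\<And>a b. P (monomial [H a, H b] - (if a = b then monomial [H a] else 0))"
    and "\<And>g b. g \<in> L \<Longrightarrow> P (monomial [g, H b] - monomial [H (\<pi> g b), g])"
  shows "P r"
  using relation_cases[OF assms(1)] relation_equation assms by blast

text \<open>The counit module is interpreted only inside proofs: over the base field, the scaling rules of a
  vector space are permanent rewrite rules that run against associativity of multiplication.\<close>

lemma counit_free: "free_algebra_module ((*) :: 'k \<Rightarrow> 'k \<Rightarrow> 'k) UNIV (\<lambda>g m. counit_letter g * m)"
  by (intro free_algebra_module.intro vector_space_mult, unfold_locales)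
    (simp_all add: algebra_simps module.subspace_UNIV[OF module_mult])

lemma counit_word: "set w \<subseteq> L \<Longrightarrow> fold (\<lambda>g m. counit_letter g * m) w m = m"
  by (induction w arbitrary: m) (simp_all)

lemma counit_ideal:
  assumes "p \<in> relation_ideal H Rel"
  shows "free_algebra_module.act (*) (\<lambda>g m. counit_letter g * m) p m = 0"
proof -
  interpret counit_free: free_algebra_module "(*) :: 'k \<Rightarrow> 'k \<Rightarrow> 'k" UNIV "\<lambda>g m. counit_letter g * m"
    by (rule counit_free)
  show ?thesis
  proof (rule counit_free.relation_ideal_annihilates[OF _ _ _ assms])
    fix r m assume "r \<in> Rel"
    then show "counit_free.act r m = 0"
    proof (induction rule: relation_induct)
      case (words v w)
      then show ?case by (simp add: counit_free.act_diff counit_free.act_monomial counit_word)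
    next
      case (orthogonal a b)
      have "counit_letter (H b) * (counit_letter (H a) * m)
          = (if a = b then counit_letter (H a) * m else 0)"
        by simp
      then show ?case
        by (simp add: counit_free.act_diff counit_free.act_monomial counit_free.act_zero
            split: if_splits)
    next
      case (permute g b)
      have "\<pi> g b = e \<longleftrightarrow> b = e" using permute \<pi>_e \<pi>_eq_iff by metis
      then show ?case by (simp add: counit_free.act_diff counit_free.act_monomial )
    qed
  next
    fix m assume "finite (UNIV :: 'x set)"
    then show "(\<Sum>a\<in>UNIV. counit_letter (H a) * m) = m"
      by (simp add: if_distribR if_distrib[of "\<lambda>c. c * m"] cong: if_cong)
  next
    fix p m assume "\<And>a m. m \<in> UNIV \<Longrightarrow> counit_free.act p (counit_letter (H a) * m) = 0"
    \<comment> \<open>\<open>h\<^sub>e\<close> acts as the identity.\<close>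
    from this[of m e] show "counit_free.act p m = 0" by simp
  qed simp

qed

lemma counit_module:
  "presented_module s gen H Rel ((*) :: 'k \<Rightarrow> 'k \<Rightarrow> 'k) UNIV (\<lambda>g m. counit_letter g * m)"
  by (intro presented_module.intro presented_module_axioms.intro presented_algebra_axioms counit_free
      counit_ideal)

sublocale antipode_free: free_algebra_module s UNIV "\<lambda>g m. antipode_letter g * m"
  by unfold_locales (simp_all add: algebra_simps scale_mult_right)

text \<open>A word of invertible letters acts as the inverse of its value; hence words with equal values act
  equally.\<close>

lemma antipode_word:
  assumes "set w \<subseteq> L"
  shows "prod_list (map gen w) * fold (\<lambda>g m. antipode_letter g * m) w m = m"
    "fold (\<lambda>g m. antipode_letter g * m) w (prod_list (map gen w) * m) = m"
  using assms
proof (induction w arbitrary: m)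
  case (Cons g w)
  { case 1
    then show ?case using Cons.IH
      by (simp add: mult.assoc) (simp add: mult.assoc[symmetric] gen_inv)
  next
    case 2
    then have "antipode_letter g * (gen g * z) = z" for z
      by (simp add: inv_gen mult.assoc[symmetric])
    then show ?case using Cons.IH(2)[of m] 2 by (simp add: mult.assoc) }
qed simp_all

lemma antipode_act_right: "antipode_free.act p (m * m') = antipode_free.act p m * m'"
proof -
  have "fold (\<lambda>g m. antipode_letter g * m) w (m * m') = fold (\<lambda>g m. antipode_letter g * m) w m * m'"
    for w
    by (induction w arbitrary: m) (simp_all add: mult.assoc[symmetric])
  then show ?thesis
    by (simp add: antipode_free.act_def sum_distrib_right scale_mult_left)
qed

lemma antipode_ideal:
  assumes "p \<in> relation_ideal H Rel"
  shows "antipode_free.act p m = 0"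
proof (rule antipode_free.relation_ideal_annihilates[OF _ _ _ assms])
  fix r m assume "r \<in> Rel"
  then show "antipode_free.act r m = 0"
  proof (induction rule: relation_induct)
    case (words v w)
    then have "fold (\<lambda>g m. antipode_letter g * m) v m = fold (\<lambda>g m. antipode_letter g * m) w m"
      using antipode_word(2)[of v "fold (\<lambda>g m. antipode_letter g * m) w m"] antipode_word(1)[of w m]
      by simp
    then show ?case by (simp add: antipode_free.act_diff antipode_free.act_monomial)
  next
    case (orthogonal a b)
    have "antipode_letter (H b) * (antipode_letter (H a) * m)
        = (if a = b then antipode_letter (H a) * m else 0)"
      by (simp add: h_h star_eq_iff)
    then show ?case
      by (simp add: antipode_free.act_diff antipode_free.act_monomial antipode_free.act_zero
          split: if_splits)
  next
    case (permute g b)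
    then have "h (star b) * (inv_gen g * m) = inv_gen g * (h (star (\<pi> g b)) * m)"
      using inv_gen_h[of g "star b"] by (simp add: mult.assoc[symmetric] \<pi>_star)
    with permute show ?case
      by (simp add: antipode_free.act_diff antipode_free.act_monomial )
  qed
next
  fix m assume fin: "finite (UNIV :: 'x set)"
  have "bij star" by (rule o_bij[of star]) (simp_all add: fun_eq_iff)
  then have "(\<Sum>a\<in>UNIV. h (star a)) = (\<Sum>a\<in>UNIV. h a)" by (rule sum.reindex_bij_betw)
  with sum_unit[OF fin] show "(\<Sum>a\<in>UNIV. antipode_letter (H a) * m) = m"
    by (simp add: sum_distrib_right[symmetric] gen_H)
next
  fix p m assume *: "\<And>a m. m \<in> UNIV \<Longrightarrow> antipode_free.act p (antipode_letter (H a) * m) = 0"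
  \<comment> \<open>\<open>act p 1\<close> is the candidate for the antipode of \<open>p\<close>, and \<open>act p\<close> is left multiplication by it.\<close>
  have "antipode_free.act p 1 * h a = 0" for a
    using *[of 1 "star a"] antipode_act_right[of p 1 "h a"] by simp
  then have "antipode_free.act p 1 = 0" by (rule zero_if_right_zero)
  then show "antipode_free.act p m = 0" using antipode_act_right[of p 1 m] by simp
qed simp

sublocale antipode: presented_module s gen H Rel s UNIV "\<lambda>g m. antipode_letter g * m"
  by unfold_locales (simp add: antipode_ideal)

sublocale comult_free: free_algebra_module form_scale "forms2 s h" comult_letter
proof unfold_locales
  show "form_space.subspace (forms2 s h)" by (rule forms2_subspace)
next
  fix \<beta> g assume "\<beta> \<in> forms2 s h"
  then show "comult_letter g \<beta> \<in> forms2 s h"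
    by (simp add: comult_letter_def shift_forms2 decompose_forms2)
next
  fix \<beta> \<beta>' g assume "\<beta> \<in> forms2 s h" "\<beta>' \<in> forms2 s h"
  then show "comult_letter g (\<beta> + \<beta>') = comult_letter g \<beta> + comult_letter g \<beta>'"
    by (simp add: comult_letter_def decompose_add) (simp add: shift_def fun_eq_iff)
next
  fix \<beta> g c assume "\<beta> \<in> forms2 s h"
  then show "comult_letter g (form_scale c \<beta>) = form_scale c (comult_letter g \<beta>)"
    by (simp add: comult_letter_def decompose_scale) (simp add: shift_def fun_eq_iff form_scale_def)
qed

lemma comult_word:
  assumes "set w \<subseteq> L"
  shows "fold comult_letter w \<beta> = shift (prod_list (map gen w)) (prod_list (map gen w)) \<beta>"
  using assms
  by (induction w arbitrary: \<beta>) (simp_all add: , simp_all add: shift_def mult.assoc)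

lemma decompose_decompose:
  assumes "\<beta> \<in> forms2 s h"
  shows "decompose b (decompose a \<beta>) = (if a = b then decompose a \<beta> else 0)"
proof -
  obtain F where F: "finite F" "supports2 h F \<beta>" using assms by (rule forms2_support)
  have "decompose b (decompose a \<beta>) x y
      = (\<Sum>d\<in>F. \<Sum>c\<in>F. \<beta> (h c * (h d * x)) (h (bul (star c) a) * (h (bul (star d) b) * y)))" for x y
    using F assms by (simp add: decompose_eq[of F] supports2_decompose)
  also have "\<dots> x y = (\<Sum>d\<in>F. \<Sum>c\<in>F. if c = d then
      (if a = b then \<beta> (h c * x) (h (bul (star c) a) * y) else 0) else 0)" for x y
    by (intro sum.cong refl) (auto simp: h_h forms2_simps[OF assms] X.left_cancel)
  finally show ?thesis
    using F by (auto simp: fun_eq_iff decompose_eq[of F])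
qed

text \<open>The comultiplication respects \<open>g h\<^sub>b = h\<^sub>c g\<close>, where \<open>c = \<pi>(b)\<close>, because the automorphism \<open>\<pi>\<close>
  maps the pairs with product \<open>b\<close> bijectively to those with product \<open>c\<close>.\<close>

lemma decompose_permute:
  assumes "g \<in> L"
  shows "decompose b (shift (gen g) (gen g) \<beta>) = shift (gen g) (gen g) (decompose (\<pi> g b) \<beta>)"
proof (intro ext)
  fix x y
  show "decompose b (shift (gen g) (gen g) \<beta>) x y = shift (gen g) (gen g) (decompose (\<pi> g b) \<beta>) x y"
    unfolding decompose_def shift_def
  proof (rule Sum_any.reindex_cong[OF bij_\<pi>[OF assms], symmetric], rule ext)
    fix c
    show "((\<lambda>d. \<beta> (h d * (gen g * x)) (h (bul (star d) (\<pi> g b)) * (gen g * y))) \<circ> \<pi> g) c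
      = \<beta> (gen g * (h c * x)) (gen g * (h (bul (star c) b) * y))"
      using assms by (simp add: gen_h_left \<pi>_hom \<pi>_star)
  qed
qed

lemma comult_ideal:
  assumes "p \<in> relation_ideal H Rel" "\<beta> \<in> forms2 s h"
  shows "comult_free.act p \<beta> = 0"
proof (rule comult_free.relation_ideal_annihilates[OF _ _ _ assms])
  fix r \<beta> assume "r \<in> Rel" and \<beta>: "\<beta> \<in> forms2 s h"
  then show "comult_free.act r \<beta> = 0"
  proof (induction rule: relation_induct)
    case (words v w)
    then show ?case by (simp add: comult_free.act_diff comult_free.act_monomial comult_word)
  next
    case (orthogonal a b)
    then have "comult_letter (H b) (comult_letter (H a) \<beta>)
        = (if a = b then comult_letter (H a) \<beta> else 0)"
      by (simp add: decompose_decompose)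
    then show ?case
      by (simp add: comult_free.act_diff comult_free.act_monomial comult_free.act_zero
          split: if_splits)
  next
    case (permute g b)
    then show ?case
      by (simp add: comult_free.act_diff comult_free.act_monomial  decompose_permute)
  qed
next
  fix \<beta> assume fin: "finite (UNIV :: 'x set)" and \<beta>: "\<beta> \<in> forms2 s h"
  obtain F where "supports2 h F \<beta>" using \<beta> by (rule forms2_support)
  then have supp: "supports2 h UNIV \<beta>" by (rule supports2_mono[rotated]) simp
  have "(\<Sum>a\<in>UNIV. decompose a \<beta> x y) = \<beta> x y" for x y
  proof -
    have "(\<Sum>a\<in>UNIV. decompose a \<beta> x y) = (\<Sum>b\<in>UNIV. \<Sum>a\<in>UNIV. \<beta> (h b * x) (h (bul (star b) a) * y))"
      by (subst sum.swap) (simp add: decompose_eq[OF fin supp])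
    also have "\<dots> = (\<Sum>b\<in>UNIV. \<Sum>a\<in>UNIV. \<beta> (h b * x) (h a * y))"
    proof (rule sum.cong[OF refl])
      fix b
      have "bij (bul (star b))"
        by (rule o_bij[of "bul b"]) (simp_all add: fun_eq_iff X.assoc[symmetric])
      then show "(\<Sum>a\<in>UNIV. \<beta> (h b * x) (h (bul (star b) a) * y)) = (\<Sum>a\<in>UNIV. \<beta> (h b * x) (h a * y))"
        by (rule sum.reindex_bij_betw)
    qed
    also have "\<dots> = \<beta> x y" by (rule supports2_expand[OF \<beta> fin supp, symmetric])
    finally show ?thesis .
  qed
  then show "(\<Sum>a\<in>UNIV. comult_letter (H a) \<beta>) = \<beta>"
    by (simp add: fun_eq_iff sum_fun_apply)
next
  fix p \<beta>
  assume *: "\<And>a \<beta>. \<beta> \<in> forms2 s h \<Longrightarrow> comult_free.act p (comult_letter (H a) \<beta>) = 0"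
    and \<beta>: "\<beta> \<in> forms2 s h"
  obtain F where F: "finite F" "supports2 h F \<beta>" using \<beta> by (rule forms2_support)
  \<comment> \<open>A component is fixed by \<open>h\<^sub>b\<^sub>c\<close>, so \<open>p\<close> acts on it as \<open>h\<^sub>b\<^sub>c p\<close> does.\<close>
  have "comult_free.act p (shift (h b) (h c) \<beta>) = 0" for b c
    using *[OF shift_forms2[OF \<beta>], of "bul b c" "h b" "h c"] \<beta>
    by (simp add: decompose_shift)
  moreover have "comult_free.act p \<beta> = comult_free.act p (\<Sum>(b, c)\<in>F \<times> F. shift (h b) (h c) \<beta>)"
    using shift_expand[OF \<beta> F] by simp
  ultimately show "comult_free.act p \<beta> = 0"
    using \<beta> by (simp add: comult_free.act_vector_sum shift_forms2 case_prod_unfold)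
qed

sublocale comult: presented_module s gen H Rel form_scale "forms2 s h" comult_letter
  by unfold_locales (rule comult_ideal)

end

section \<open>Formal sums and forms in three arguments\<close>

lemma formal_sum_eq_Sum_any: "formal_sum UNIV t \<beta> = Sum_any (\<lambda>i. t i \<beta>)"
  by (simp add: formal_sum_def Sum_any.expand_set)

lemma contracts_toI:
  assumes "\<And>\<phi>. \<phi> \<in> forms1 s h
    \<Longrightarrow> finite {(b, c). \<Theta> (\<lambda>x y. \<phi> (f (h b * x) (h c * y))) \<noteq> 0}
      \<and> Sum_any (\<lambda>(b, c). \<Theta> (\<lambda>x y. \<phi> (f (h b * x) (h c * y)))) = \<phi> z"
  shows "contracts_to s h f \<Theta> z"
  using assms by (simp add: contracts_to_def Let_def Sum_any.expand_set case_prod_unfold)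

definition supports3 ::
  "('x \<Rightarrow> 'a::ring_1) \<Rightarrow> 'x set \<Rightarrow> ('a \<Rightarrow> 'a \<Rightarrow> 'a \<Rightarrow> 'k::zero) \<Rightarrow> bool" where
  "supports3 h F \<gamma> \<longleftrightarrow> (\<forall>x y z. vanishes_on h F x \<or> vanishes_on h F y \<or> vanishes_on h F z
     \<longrightarrow> \<gamma> x y z = 0)"

lemma (in k_algebra) forms3_iff:
  "\<gamma> \<in> forms3 scale h \<longleftrightarrow> (\<forall>y z. linear_form scale (\<lambda>x. \<gamma> x y z))
    \<and> (\<forall>x z. linear_form scale (\<lambda>y. \<gamma> x y z)) \<and> (\<forall>x y. linear_form scale (\<gamma> x y))
    \<and> (\<exists>F. finite F \<and> supports3 h F \<gamma>)"
  by (simp add: forms3_def supports3_def)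

section \<open>The Hopf algebra structure\<close>

context permuted_idempotents
begin

lemma forms1_linear: "\<phi> \<in> forms1 s h \<Longrightarrow> linear_form s \<phi>"
  by (simp add: forms1_iff)

lemmas forms1_simps = linear_form_simps[OF forms1_linear]

lemma forms1_support:
  assumes "\<phi> \<in> forms1 s h"
  obtains F where "finite F" "\<And>x. vanishes_on h F x \<Longrightarrow> \<phi> x = 0"
  using assms by (auto simp: forms1_iff)

lemma forms1_expand:
  assumes "\<phi> \<in> forms1 s h" "finite F" "\<And>x. vanishes_on h F x \<Longrightarrow> \<phi> x = 0"
  shows "\<phi> x = (\<Sum>b\<in>F. \<phi> (h b * x))"
  using assms(3)[OF vanishes_on_remainder[OF assms(2), of x]] by (simp add: forms1_simps[OF assms(1)])

lemma forms1_translate: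
  assumes "\<phi> \<in> forms1 s h"
  shows "(\<lambda>z. \<phi> (x * z * y)) \<in> forms1 s h"
proof -
  obtain F where F: "finite F" "\<And>x. vanishes_on h F x \<Longrightarrow> \<phi> x = 0"
    using assms by (rule forms1_support) blast
  obtain F' where F': "finite F'" "\<And>z. vanishes_on h F' z \<Longrightarrow> vanishes_on h F (x * z)"
    using vanishes_on_mult[OF F(1), of x] by blast
  have "\<phi> (x * z * y) = 0" if "vanishes_on h F' z" for z
    using F'(2)[OF that] by (intro F(2)) (simp add: vanishes_on_def mult.assoc[symmetric])
  with F' show ?thesis
    using forms1_simps[OF assms]
    by (auto simp: forms1_iff linear_form_iff distrib_left distrib_right scale_mult_left scale_mult_right)
qed

lemma letter_induct [case_names one add scale group_like idempotent]:
  assumes "P 1" and "\<And>x y. P x \<Longrightarrow> P y \<Longrightarrow> P (x + y)" and "\<And>c x. P x \<Longrightarrow> P (s c x)"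
    and "\<And>g x. g \<in> L \<Longrightarrow> P x \<Longrightarrow> P (gen g * x)" and "\<And>a x. P x \<Longrightarrow> P (h a * x)"
  shows "P x"
proof (induction x rule: generators_induct)
  case (letter g x)
  then show ?case using assms(4,5) by (cases g rule: letter_cases) (auto simp: gen_H)
qed (fact assms(1-3))+

subsection \<open>Counit and antipode\<close>

definition \<epsilon> :: "'b \<Rightarrow> 'k" where
  "\<epsilon> x = presented_module.rep s gen (*) (\<lambda>g m. counit_letter g * m) x 1"

definition S :: "'b \<Rightarrow> 'b" where "S x = antipode.rep x 1"

lemma counit_simps [simp]:
  "\<epsilon> 1 = 1" "\<epsilon> (x + y) = \<epsilon> x + \<epsilon> y" "\<epsilon> (s c x) = c * \<epsilon> x"
  "g \<in> L \<Longrightarrow> \<epsilon> (gen g * x) = \<epsilon> x" "\<epsilon> (h a * x) = (if a = e then \<epsilon> x else 0)"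
proof -
  interpret counit: presented_module s gen H Rel "(*) :: 'k \<Rightarrow> 'k \<Rightarrow> 'k" UNIV
    "\<lambda>g m. counit_letter g * m"
    by (rule counit_module)
  show "\<epsilon> 1 = 1" "\<epsilon> (x + y) = \<epsilon> x + \<epsilon> y" "\<epsilon> (s c x) = c * \<epsilon> x"
    "g \<in> L \<Longrightarrow> \<epsilon> (gen g * x) = \<epsilon> x" "\<epsilon> (h a * x) = (if a = e then \<epsilon> x else 0)"
    using counit.rep_letter[of 1 "H a" x] counit.rep_vector_zero[of x]
    by (simp_all add: \<epsilon>_def counit.rep_one counit.rep_add counit.rep_scale counit.rep_letter gen_H)
qed

lemma counit_mult: "\<epsilon> (x * y) = \<epsilon> x * \<epsilon> y"
  by (induction x rule: letter_induct) (simp_all add: algebra_simps scale_mult_left)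

lemma antipode_rep: "antipode.rep x m = S x * m"
  unfolding S_def antipode.rep_def by (subst antipode_act_right[symmetric]) simp

lemma antipode_simps [simp]:
  "S 1 = 1" "S (x + y) = S x + S y" "S (s c x) = s c (S x)"
  "g \<in> L \<Longrightarrow> S (gen g * x) = S x * inv_gen g" "S (h a * x) = S x * h (star a)"
proof -
  show "S 1 = 1" "S (x + y) = S x + S y" "S (s c x) = s c (S x)"
    by (simp_all add: S_def antipode.rep_one antipode.rep_add antipode.rep_scale)
  have "S (gen g * x) = S x * antipode_letter g" for g
    using antipode.rep_letter[of 1 g x] by (simp add: antipode_rep)
  from this[of g] this[of "H a"]
  show "g \<in> L \<Longrightarrow> S (gen g * x) = S x * inv_gen g" "S (h a * x) = S x * h (star a)"
    by (simp_all add: gen_H)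
qed

lemma antipode_h [simp]: "S (h a) = h (star a)"
  using antipode_simps(5)[of a 1] by simp

lemma antipode_mult: "S (x * y) = S y * S x"
  by (induction x rule: letter_induct)
    (simp_all add: distrib_left distrib_right scale_mult_left scale_mult_right mult.assoc)

subsection \<open>Comultiplication\<close>

definition \<Delta> :: "'b \<Rightarrow> ('k, 'b) tensor2" where
  "\<Delta> x = (\<lambda>\<beta>. if \<beta> \<in> forms2 s h then comult.rep x \<beta> 1 1 else 0)"

lemma comult_simps [simp]:
  assumes "\<beta> \<in> forms2 s h"
  shows "\<Delta> 1 \<beta> = \<beta> 1 1" "\<Delta> (x + y) \<beta> = \<Delta> x \<beta> + \<Delta> y \<beta>" "\<Delta> (s c x) \<beta> = c * \<Delta> x \<beta>"
    "g \<in> L \<Longrightarrow> \<Delta> (gen g * x) \<beta> = \<Delta> x (shift (gen g) (gen g) \<beta>)"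
    "\<Delta> (h a * x) \<beta> = \<Delta> x (decompose a \<beta>)"
  using assms comult.rep_letter[of \<beta> "H a" x]
  by (simp_all add: \<Delta>_def comult.rep_one comult.rep_add comult.rep_scale comult.rep_letter gen_H
      form_scale_def shift_forms2 decompose_forms2)

lemma comult_zero: "\<Delta> 0 \<beta> = 0"
  using comult_simps(3)[of \<beta> 0 0] by (cases "\<beta> \<in> forms2 s h") (simp_all add: \<Delta>_def)

lemma comult_form_add:
  "\<beta> \<in> forms2 s h \<Longrightarrow> \<beta>' \<in> forms2 s h \<Longrightarrow> \<Delta> x (\<beta> + \<beta>') = \<Delta> x \<beta> + \<Delta> x \<beta>'"
  using comult_free.M_closed(2)[of \<beta> \<beta>'] by (simp add: \<Delta>_def comult.rep_vector_add)

lemma comult_form_scale: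
  "\<beta> \<in> forms2 s h \<Longrightarrow> \<Delta> x (form_scale c \<beta>) = c * \<Delta> x \<beta>"
  using comult_free.M_closed(3)[of \<beta> c]
  by (simp add: \<Delta>_def comult.rep_vector_scale) (simp add: form_scale_def)

lemma comult_form_zero: "\<Delta> x 0 = 0"
  by (simp add: \<Delta>_def comult.rep_vector_zero)

lemma comult_form_sum:
  "(\<And>i. i \<in> I \<Longrightarrow> f i \<in> forms2 s h) \<Longrightarrow> \<Delta> x (sum f I) = (\<Sum>i\<in>I. \<Delta> x (f i))"
  using comult_free.M_closed(4)[of I f]
  by (simp add: \<Delta>_def comult.rep_vector_sum sum_fun_apply)

lemma comult_idempotent:
  assumes "\<beta> \<in> forms2 s h"
  shows "\<Delta> (h a * x) (shift (h b) (h c) \<beta>) = (if bul b c = a then \<Delta> x (shift (h b) (h c) \<beta>) else 0)"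
  using assms by (simp add: shift_forms2 decompose_shift comult_form_zero)

lemma comult_expand:
  assumes "\<beta> \<in> forms2 s h" "finite F" "supports2 h F \<beta>"
  shows "\<Delta> x \<beta> = (\<Sum>(b, c)\<in>F \<times> F. \<Delta> x (shift (h b) (h c) \<beta>))"
  by (subst shift_expand[OF assms], subst comult_form_sum)
    (auto simp: shift_forms2 assms case_prod_unfold)

text \<open>If \<open>\<beta>\<close> only sees components in \<open>F\<close>, then \<open>\<Delta> x \<beta>\<close> only sees the components \<open>h\<^sub>b\<^sub>c x\<close> with \<open>b\<close>, \<open>c\<close> in
  \<open>F\<close>. This is the compatibility of \<open>\<Delta>\<close> with formal sums.\<close>

lemma comult_vanishes:
  assumes "\<beta> \<in> forms2 s h" "finite F" "supports2 h F \<beta>"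
    and "vanishes_on h ((\<lambda>(b, c). bul b c) ` (F \<times> F)) x"
  shows "\<Delta> x \<beta> = 0"
proof -
  have "\<Delta> x (shift (h b) (h c) \<beta>) = 0" if "b \<in> F" "c \<in> F" for b c
  proof -
    have "h (bul b c) * x = 0" using assms(4) that by (force simp: vanishes_on_def)
    then show ?thesis
      using comult_idempotent[OF assms(1), of "bul b c" x b c] by (simp add: comult_zero)
  qed
  then show ?thesis
    by (subst comult_expand[OF assms(1-3)]) (auto intro!: sum.neutral)
qed

lemma comult_forms1:
  assumes "\<beta> \<in> forms2 s h"
  shows "(\<lambda>x. \<Delta> x \<beta>) \<in> forms1 s h"
proof -
  obtain F where F: "finite F" "supports2 h F \<beta>" using assms by (rule forms2_support)
  show ?thesis
    unfolding forms1_iff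
  proof (intro conjI exI)
    show "linear_form s (\<lambda>x. \<Delta> x \<beta>)" using assms by (simp add: linear_form_iff)
    show "finite ((\<lambda>(b, c). bul b c) ` (F \<times> F))" using F by simp
    show "\<forall>x. vanishes_on h ((\<lambda>(b, c). bul b c) ` (F \<times> F)) x \<longrightarrow> \<Delta> x \<beta> = 0"
      using comult_vanishes[OF assms F] by blast
  qed
qed

lemma shift_shift: "shift x' y' (shift x y \<beta>) = shift (x * x') (y * y') \<beta>" for x :: 'b
  by (simp add: shift_def mult.assoc)

text \<open>The inner functional in a product of tensors is again an admissible form. The support of \<open>\<beta>\<close>
  serves for it, since \<open>h\<^sub>a x = 0\<close> implies \<open>h\<^sub>a x x' = 0\<close>.\<close>

lemma functional_shift_forms2:
  assumes "\<beta> \<in> forms2 s h"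
    and add: "\<And>\<beta> \<beta>'. \<beta> \<in> forms2 s h \<Longrightarrow> \<beta>' \<in> forms2 s h \<Longrightarrow> \<Theta> (\<beta> + \<beta>') = \<Theta> \<beta> + \<Theta> \<beta>'"
    and scale: "\<And>c \<beta>. \<beta> \<in> forms2 s h \<Longrightarrow> \<Theta> (form_scale c \<beta>) = c * \<Theta> \<beta>"
    and F: "finite F" "supports2 h F \<beta>"
  shows "(\<lambda>x y. \<Theta> (shift x y \<beta>)) \<in> forms2 s h" "supports2 h F (\<lambda>x y. \<Theta> (shift x y \<beta>))"
proof -
  have zero: "\<Theta> 0 = 0"
    using scale[OF assms(1), of 0] by (simp add: form_scale_def zero_fun_def)
  have "shift x y \<beta> = 0" if "vanishes_on h F x \<or> vanishes_on h F y" for x y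
  proof -
    have "vanishes_on h F (x * z) \<or> vanishes_on h F (y * z')" for z z'
      using that by (auto simp: vanishes_on_def mult.assoc[symmetric])
    then show ?thesis using F(2) by (auto simp: fun_eq_iff shift_def supports2_def)
  qed
  then show supp: "supports2 h F (\<lambda>x y. \<Theta> (shift x y \<beta>))"
    by (auto simp: supports2_def zero)
  have "shift (x + x') y \<beta> = shift x y \<beta> + shift x' y \<beta>" "shift y (x + x') \<beta> = shift y x \<beta> + shift y x' \<beta>"
    "shift (s c x) y \<beta> = form_scale c (shift x y \<beta>)" "shift y (s c x) \<beta> = form_scale c (shift y x \<beta>)"
    for x x' y c
    by (simp_all add: fun_eq_iff shift_def form_scale_def distrib_right scale_mult_left
        forms2_simps[OF assms(1)])
  with supp F(1) show "(\<lambda>x y. \<Theta> (shift x y \<beta>)) \<in> forms2 s h"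
    by (intro forms2I[of _ F]) (simp_all add: add scale shift_forms2 assms(1))
qed

lemma comult_shift_forms2:
  assumes "\<beta> \<in> forms2 s h" "finite F" "supports2 h F \<beta>"
  shows "(\<lambda>x' y'. \<Delta> x (shift x' y' \<beta>)) \<in> forms2 s h"
    "supports2 h F (\<lambda>x' y'. \<Delta> x (shift x' y' \<beta>))"
  by (rule functional_shift_forms2[OF assms(1) comult_form_add comult_form_scale assms(2,3)];
      assumption)+

lemma comult_mult:
  assumes "\<beta> \<in> forms2 s h"
  shows "\<Delta> (x * y) \<beta> = \<Delta> x (\<lambda>x' y'. \<Delta> y (shift x' y' \<beta>))"
  using assms
proof (induction x arbitrary: \<beta> rule: letter_induct)
  case one
  obtain F where F: "finite F" "supports2 h F \<beta>" using one by (rule forms2_support)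
  show ?case using comult_shift_forms2(1)[OF one F, of y] by simp (simp add: shift_def)
next
  case (add x x')
  obtain F where F: "finite F" "supports2 h F \<beta>" using add.prems by (rule forms2_support)
  show ?case using comult_shift_forms2(1)[OF add.prems F, of y] add by (simp add: distrib_right)
next
  case (scale c x)
  obtain F where F: "finite F" "supports2 h F \<beta>" using scale.prems by (rule forms2_support)
  show ?case using comult_shift_forms2(1)[OF scale.prems F, of y] scale by (simp add: scale_mult_left)
next
  case (group_like g x)
  obtain F where F: "finite F" "supports2 h F \<beta>" using group_like.prems by (rule forms2_support)
  have "shift (gen g) (gen g) (\<lambda>x' y'. \<Delta> y (shift x' y' \<beta>))
      = (\<lambda>x' y'. \<Delta> y (shift x' y' (shift (gen g) (gen g) \<beta>)))"
    by (simp add: shift_shift) (simp add: shift_def)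
  then show ?case
    using comult_shift_forms2(1)[OF group_like.prems F, of y] group_like
    by (simp add: mult.assoc shift_forms2)
next
  case (idempotent a x)
  obtain F where F: "finite F" "supports2 h F \<beta>" using idempotent.prems by (rule forms2_support)
  note form = comult_shift_forms2[OF idempotent.prems F, of y]
  have "decompose a (\<lambda>x' y'. \<Delta> y (shift x' y' \<beta>)) x' y' = \<Delta> y (shift x' y' (decompose a \<beta>))" for x' y'
  proof -
    have "shift x' y' (decompose a \<beta>) = (\<Sum>b\<in>F. shift (h b * x') (h (bul (star b) a) * y') \<beta>)"
      using F by (simp add: fun_eq_iff sum_fun_apply shift_def decompose_eq[of F] mult.assoc)
    then show ?thesis
      using F form idempotent.prems by (simp add: decompose_eq[of F] comult_form_sum shift_forms2)
  qed
  then have "decompose a (\<lambda>x' y'. \<Delta> y (shift x' y' \<beta>)) = (\<lambda>x' y'. \<Delta> y (shift x' y' (decompose a \<beta>)))"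
    by blast
  then show ?case
    using form(1) idempotent by (simp add: mult.assoc decompose_forms2)
qed

lemma comult_mult2: "\<Delta> (x * y) = mult2 s h (\<Delta> x) (\<Delta> y)"
proof
  fix \<beta>
  show "\<Delta> (x * y) \<beta> = mult2 s h (\<Delta> x) (\<Delta> y) \<beta>"
  proof (cases "\<beta> \<in> forms2 s h")
    case True
    then show ?thesis using comult_mult[OF True] by (simp add: mult2_def shift_def)
  next
    case False
    then show ?thesis by (simp add: mult2_def \<Delta>_def)
  qed
qed

lemma comult_one: "\<Delta> 1 = pure2 s h 1 1"
  by (auto simp: pure2_def fun_eq_iff) (simp add: \<Delta>_def)

lemma comult_group_like:
  assumes "g \<in> L"
  shows "\<Delta> (gen g) = pure2 s h (gen g) (gen g)"
proof
  fix \<beta>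
  have "\<Delta> (gen g) \<beta> = \<beta> (gen g) (gen g)" if "\<beta> \<in> forms2 s h"
    using comult_simps(4)[OF that assms, of 1] that by (simp add: shift_forms2) (simp add: shift_def)
  then show "\<Delta> (gen g) \<beta> = pure2 s h (gen g) (gen g) \<beta>"
    by (auto simp: pure2_def) (simp add: \<Delta>_def)
qed

lemma comult_idempotent_letter:
  "\<Delta> (h a) = formal_sum {(b, c). bul b c = a} (\<lambda>(b, c). pure2 s h (h b) (h c))"
proof
  fix \<beta>
  show "\<Delta> (h a) \<beta> = formal_sum {(b, c). bul b c = a} (\<lambda>(b, c). pure2 s h (h b) (h c)) \<beta>"
  proof (cases "\<beta> \<in> forms2 s h")
    case True
    have "\<Delta> (h a) \<beta> = Sum_any (\<lambda>b. \<beta> (h b) (h (bul (star b) a)))"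
      using comult_simps(5)[OF True, of a 1] True by (simp add: decompose_forms2) (simp add: decompose_def)
    also have "\<dots> = (\<Sum>(b, c)\<in>{p\<in>{(b, c). bul b c = a}. \<beta> (h (fst p)) (h (snd p)) \<noteq> 0}. \<beta> (h b) (h c))"
      unfolding Sum_any.expand_set
      by (rule sum.reindex_bij_witness[where i = fst and j = "\<lambda>b. (b, bul (star b) a)"])
        (auto simp: bul_eq_iff)
    finally show ?thesis
      using True by (simp add: formal_sum_def pure2_def case_prod_unfold)
  next
    case False
    then show ?thesis by (simp add: \<Delta>_def formal_sum_def pure2_def case_prod_unfold)
  qed
qed

lemma comult_components:
  assumes "\<beta> \<in> forms2 s h"
  shows "finite {(b, c). \<Delta> x (shift (h b) (h c) \<beta>) \<noteq> 0}"
    "Sum_any (\<lambda>(b, c). \<Delta> x (shift (h b) (h c) \<beta>)) = \<Delta> x \<beta>"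
proof -
  obtain F where F: "finite F" "supports2 h F \<beta>" using assms by (rule forms2_support)
  have zero: "\<Delta> x (shift (h b) (h c) \<beta>) = 0" if "b \<notin> F \<or> c \<notin> F" for b c
  proof -
    have "shift (h b) (h c) \<beta> = 0"
      using that supports2_outside[OF F(2)] by (auto simp: shift_def fun_eq_iff)
    then show ?thesis by (simp only: comult_form_zero)
  qed
  have sub: "{p. (case p of (b, c) \<Rightarrow> \<Delta> x (shift (h b) (h c) \<beta>)) \<noteq> 0} \<subseteq> F \<times> F"
  proof
    fix p assume p: "p \<in> {p. (case p of (b, c) \<Rightarrow> \<Delta> x (shift (h b) (h c) \<beta>)) \<noteq> 0}"
    obtain b c where "p = (b, c)" by (cases p)
    with p zero[of b c] show "p \<in> F \<times> F" by auto
  qed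
  then show "finite {(b, c). \<Delta> x (shift (h b) (h c) \<beta>) \<noteq> 0}"
    using F(1) by (auto intro: finite_subset simp: case_prod_unfold)
  show "Sum_any (\<lambda>(b, c). \<Delta> x (shift (h b) (h c) \<beta>)) = \<Delta> x \<beta>"
    using Sum_any.expand_superset[OF _ sub] comult_expand[OF assms F, of x] F(1) by simp
qed

text \<open>Each component of \<open>\<Delta> x\<close> is an ordinary finite tensor: on products of generators it is a single
  pure tensor or zero.\<close>

lemma comult_component_pure:
  "\<exists>l. \<forall>\<beta>\<in>forms2 s h. \<Delta> x (shift (h b) (h c) \<beta>) = (\<Sum>(y, z)\<leftarrow>l. \<beta> (h b * y) (h c * z))"
proof (induction x arbitrary: b c rule: letter_induct)
  case one
  show ?case by (rule exI[of _ "[(1, 1)]"]) (simp add: shift_forms2, simp add: shift_def)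
next
  case (add x y)
  from add.IH obtain l l' where
    "\<forall>\<beta>\<in>forms2 s h. \<Delta> x (shift (h b) (h c) \<beta>) = (\<Sum>(y, z)\<leftarrow>l. \<beta> (h b * y) (h c * z))"
    "\<forall>\<beta>\<in>forms2 s h. \<Delta> y (shift (h b) (h c) \<beta>) = (\<Sum>(y, z)\<leftarrow>l'. \<beta> (h b * y) (h c * z))"
    by metis
  then show ?case by (intro exI[of _ "l @ l'"]) (simp add: shift_forms2)
next
  case (scale d x)
  from scale.IH obtain l where
    "\<forall>\<beta>\<in>forms2 s h. \<Delta> x (shift (h b) (h c) \<beta>) = (\<Sum>(y, z)\<leftarrow>l. \<beta> (h b * y) (h c * z))" by metis
  then show ?case
    by (intro exI[of _ "map (\<lambda>(y, z). (s d y, z)) l"])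
      (simp add: shift_forms2 forms2_simps scale_mult_right comp_def case_prod_unfold
        sum_list_const_mult)
next
  case (group_like g x)
  obtain b' where b: "b = \<pi> g b'" using \<pi>_surj[OF group_like(1)] .
  obtain c' where c: "c = \<pi> g c'" using \<pi>_surj[OF group_like(1)] .
  from group_like.IH[of b' c'] obtain l where l:
    "\<And>\<beta>. \<beta> \<in> forms2 s h
      \<Longrightarrow> \<Delta> x (shift (h b') (h c') \<beta>) = (\<Sum>(y, z)\<leftarrow>l. \<beta> (h b' * y) (h c' * z))" by metis
  have "\<Delta> (gen g * x) (shift (h b) (h c) \<beta>)
      = (\<Sum>(y, z)\<leftarrow>map (\<lambda>(y, z). (gen g * y, gen g * z)) l. \<beta> (h b * y) (h c * z))"
    if \<beta>: "\<beta> \<in> forms2 s h" for \<beta>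
  proof -
    have "\<Delta> (gen g * x) (shift (h b) (h c) \<beta>) = \<Delta> x (shift (h b') (h c') (shift (gen g) (gen g) \<beta>))"
      using \<beta> group_like(1) by (simp add: shift_forms2 shift_shift b c gen_h)
    also have "\<dots> = (\<Sum>(y, z)\<leftarrow>l. shift (gen g) (gen g) \<beta> (h b' * y) (h c' * z))"
      using \<beta> by (intro l shift_forms2)
    finally show ?thesis
      using group_like(1) by (simp add: b c comp_def case_prod_unfold shift_def gen_h_left)
  qed
  then show ?case by blast
next
  case (idempotent a x)
  show ?case
  proof (cases "bul b c = a")
    case True
    with idempotent[of b c] show ?thesis by (simp add: comult_idempotent del: comult_simps)
  next
    case False
    then show ?thesis by (intro exI[of _ "[]"]) (simp add: comult_idempotent del: comult_simps)
  qed
qed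

lemma comult_tensor_square: "\<Delta> x \<in> tensor_square s h"
proof -
  obtain t where t: "\<And>b c \<beta>. \<beta> \<in> forms2 s h
    \<Longrightarrow> \<Delta> x (shift (h b) (h c) \<beta>) = (\<Sum>(y, z)\<leftarrow>t b c. \<beta> (h b * y) (h c * z))"
    using comult_component_pure[of x] by metis
  have "\<Delta> x = formal_sum UNIV (\<lambda>(b, c) \<beta>. \<Sum>(y, z)\<leftarrow>t b c. pure2 s h (h b * y) (h c * z) \<beta>)"
  proof
    fix \<beta>
    show "\<Delta> x \<beta> = formal_sum UNIV (\<lambda>(b, c) \<beta>. \<Sum>(y, z)\<leftarrow>t b c. pure2 s h (h b * y) (h c * z) \<beta>) \<beta>"
    proof (cases "\<beta> \<in> forms2 s h")
      case True
      then show ?thesis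
        using comult_components(2)[OF True, of x] t[OF True]
        by (simp add: formal_sum_eq_Sum_any pure2_def case_prod_unfold)
    next
      case False
      then show ?thesis
        by (simp add: formal_sum_def pure2_def case_prod_unfold \<Delta>_def)
    qed
  qed
  then show ?thesis by (auto simp: tensor_square_def)
qed

lemma comultiplication_comult: "comultiplication s h \<Delta>"
  unfolding comultiplication_def
  using comult_tensor_square comult_forms1 comult_one comult_mult2 by blast

subsection \<open>Coassociativity\<close>

lemma forms3_slice:
  assumes "\<gamma> \<in> forms3 s h" "supports3 h F \<gamma>" "finite F"
  shows "(\<lambda>x y. \<gamma> x y z) \<in> forms2 s h" "(\<lambda>x y. \<gamma> z x y) \<in> forms2 s h"
    "supports2 h F (\<lambda>x y. \<gamma> x y z)" "supports2 h F (\<lambda>x y. \<gamma> z x y)"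
  using assms by (auto simp: forms3_iff forms2_iff supports3_def supports2_def)

lemma forms3_support:
  assumes "\<gamma> \<in> forms3 s h"
  obtains F where "finite F" "supports3 h F \<gamma>"
  using assms by (auto simp: forms3_iff)

lemma forms3_simps:
  assumes "\<gamma> \<in> forms3 s h"
  shows "\<gamma> (x + x') y z = \<gamma> x y z + \<gamma> x' y z" "\<gamma> (s c x) y z = c * \<gamma> x y z"
    "\<gamma> y (x + x') z = \<gamma> y x z + \<gamma> y x' z" "\<gamma> y (s c x) z = c * \<gamma> y x z"
    "\<gamma> y z (x + x') = \<gamma> y z x + \<gamma> y z x'" "\<gamma> y z (s c x) = c * \<gamma> y z x"
  using assms by (simp_all add: forms3_iff linear_form_iff)

definition shift3 :: "'b \<Rightarrow> 'b \<Rightarrow> 'b \<Rightarrow> ('b \<Rightarrow> 'b \<Rightarrow> 'b \<Rightarrow> 'k) \<Rightarrow> 'b \<Rightarrow> 'b \<Rightarrow> 'b \<Rightarrow> 'k" where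
  "shift3 x y z \<gamma> = (\<lambda>x' y' z'. \<gamma> (x * x') (y * y') (z * z'))"

lemma shift3_forms3:
  assumes "\<gamma> \<in> forms3 s h"
  shows "shift3 x y z \<gamma> \<in> forms3 s h"
proof -
  obtain F where F: "finite F" "supports3 h F \<gamma>" using assms by (rule forms3_support)
  obtain F1 where F1: "finite F1" "\<And>z. vanishes_on h F1 z \<Longrightarrow> vanishes_on h F (x * z)"
    using vanishes_on_mult[OF F(1), of x] by blast
  obtain F2 where F2: "finite F2" "\<And>z. vanishes_on h F2 z \<Longrightarrow> vanishes_on h F (y * z)"
    using vanishes_on_mult[OF F(1), of y] by blast
  obtain F3 where F3: "finite F3" "\<And>z'. vanishes_on h F3 z' \<Longrightarrow> vanishes_on h F (z * z')"
    using vanishes_on_mult[OF F(1), of z] by blast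
  have "supports3 h (F1 \<union> F2 \<union> F3) (shift3 x y z \<gamma>)"
    unfolding supports3_def shift3_def
  proof (intro allI impI)
    fix x' y' z'
    assume "vanishes_on h (F1 \<union> F2 \<union> F3) x' \<or> vanishes_on h (F1 \<union> F2 \<union> F3) y'
      \<or> vanishes_on h (F1 \<union> F2 \<union> F3) z'"
    then have "vanishes_on h F1 x' \<or> vanishes_on h F2 y' \<or> vanishes_on h F3 z'"
      by (auto simp: vanishes_on_def)
    then show "\<gamma> (x * x') (y * y') (z * z') = 0"
      using F(2) F1(2) F2(2) F3(2) unfolding supports3_def by blast
  qed
  then show ?thesis
    using F1(1) F2(1) F3(1)
    by (auto simp: forms3_iff linear_form_iff intro!: exI[of _ "F1 \<union> F2 \<union> F3"])
      (simp_all add: shift3_def distrib_left scale_mult_right forms3_simps[OF assms])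
qed

text \<open>Precomposition of a trilinear form with \<open>\<Delta>\<close> in its first two, respectively its last two,
  arguments; the two sides of coassociativity are \<open>\<Delta> x\<close> evaluated on these.\<close>

definition comult_fst :: "('b \<Rightarrow> 'b \<Rightarrow> 'b \<Rightarrow> 'k) \<Rightarrow> 'b \<Rightarrow> 'b \<Rightarrow> 'k" where
  "comult_fst \<gamma> = (\<lambda>x y. \<Delta> x (\<lambda>x' x''. \<gamma> x' x'' y))"

definition comult_snd :: "('b \<Rightarrow> 'b \<Rightarrow> 'b \<Rightarrow> 'k) \<Rightarrow> 'b \<Rightarrow> 'b \<Rightarrow> 'k" where
  "comult_snd \<gamma> = (\<lambda>x y. \<Delta> y (\<lambda>y' y''. \<gamma> x y' y''))"

text \<open>The argument fed into \<open>\<Delta>\<close> is supported on products of two indices from \<open>F\<close>, the other one on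
  \<open>F\<close> itself.\<close>

lemma comult_fst_forms2:
  assumes "\<gamma> \<in> forms3 s h"
  shows "comult_fst \<gamma> \<in> forms2 s h" "comult_snd \<gamma> \<in> forms2 s h"
proof -
  obtain F where F: "finite F" "supports3 h F \<gamma>" using assms by (rule forms3_support)
  note slice = forms3_slice[OF assms F(2,1)]
  let ?K = "F \<union> (\<lambda>(b, c). bul b c) ` (F \<times> F)"
  have K: "finite ?K" using F(1) by simp
  have zero: "(\<lambda>x y. \<gamma> x y z) = 0" "(\<lambda>x y. \<gamma> z x y) = 0" if "vanishes_on h F z" for z
    using that F(2) by (auto simp: fun_eq_iff supports3_def)
  have part: "vanishes_on h F x" "vanishes_on h ((\<lambda>(b, c). bul b c) ` (F \<times> F)) x"
    if "vanishes_on h ?K x" for x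
    using that by (auto intro: vanishes_on_mono[rotated])
  have null: "\<Delta> x (\<lambda>x' x''. \<gamma> x' x'' y) = 0" "\<Delta> x (\<lambda>x' x''. \<gamma> y x' x'') = 0"
    if "vanishes_on h ?K x \<or> vanishes_on h ?K y" for x y
    using that
  proof (atomize (full), elim disjE)
    assume "vanishes_on h ?K x"
    note x = part(2)[OF this]
    show "\<Delta> x (\<lambda>x' x''. \<gamma> x' x'' y) = 0 \<and> \<Delta> x (\<lambda>x' x''. \<gamma> y x' x'') = 0"
      by (intro conjI comult_vanishes[OF slice(1) F(1) slice(3) x]
          comult_vanishes[OF slice(2) F(1) slice(4) x])
  next
    assume "vanishes_on h ?K y"
    note y = zero[OF part(1)[OF this]]
    show "\<Delta> x (\<lambda>x' x''. \<gamma> x' x'' y) = 0 \<and> \<Delta> x (\<lambda>x' x''. \<gamma> y x' x'') = 0"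
      unfolding y comult_form_zero by simp
  qed
  have "supports2 h ?K (comult_fst \<gamma>)" "supports2 h ?K (comult_snd \<gamma>)"
    unfolding supports2_def comult_fst_def comult_snd_def using null by blast+
  moreover have "\<Delta> w (\<lambda>x y. \<gamma> x y (z + z')) = \<Delta> w (\<lambda>x y. \<gamma> x y z) + \<Delta> w (\<lambda>x y. \<gamma> x y z')"
    "\<Delta> w (\<lambda>x y. \<gamma> (z + z') x y) = \<Delta> w (\<lambda>x y. \<gamma> z x y) + \<Delta> w (\<lambda>x y. \<gamma> z' x y)" for w z z'
    unfolding comult_form_add[OF slice(1) slice(1), symmetric]
      comult_form_add[OF slice(2) slice(2), symmetric]
    by (simp_all add: plus_fun_def forms3_simps[OF assms])
  moreover have "\<Delta> w (\<lambda>x y. \<gamma> x y (s c z)) = c * \<Delta> w (\<lambda>x y. \<gamma> x y z)"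
    "\<Delta> w (\<lambda>x y. \<gamma> (s c z) x y) = c * \<Delta> w (\<lambda>x y. \<gamma> z x y)" for w z c
    unfolding comult_form_scale[OF slice(1), symmetric] comult_form_scale[OF slice(2), symmetric]
    by (simp_all add: form_scale_def forms3_simps[OF assms])
  ultimately show "comult_fst \<gamma> \<in> forms2 s h" "comult_snd \<gamma> \<in> forms2 s h"
    using K slice by (auto intro!: forms2I[of _ ?K] simp: comult_fst_def comult_snd_def)
qed

lemma shift3_expand:
  assumes "\<gamma> \<in> forms3 s h" "finite F" "supports3 h F \<gamma>"
  shows "\<gamma> x y z = (\<Sum>(b, c, d)\<in>F \<times> F \<times> F. shift3 (h b) (h c) (h d) \<gamma> x y z)"
proof -
  note slice = forms3_slice[OF assms(1,3,2)]
  have "\<gamma> x y z = (\<Sum>b\<in>F. \<Sum>c\<in>F. \<gamma> (h b * x) (h c * y) z)"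
    by (rule supports2_expand[OF slice(1) assms(2) slice(3)])
  also have "\<dots> = (\<Sum>b\<in>F. \<Sum>c\<in>F. \<Sum>d\<in>F. \<gamma> (h b * x) (h c * y) (h d * z))"
  proof (intro sum.cong refl)
    fix b c
    show "\<gamma> (h b * x) (h c * y) z = (\<Sum>d\<in>F. \<gamma> (h b * x) (h c * y) (h d * z))"
      using assms by (intro forms1_expand) (auto simp: forms1_iff forms3_iff supports3_def)
  qed
  finally show ?thesis
    by (simp add: sum.cartesian_product shift3_def case_prod_unfold)
qed

text \<open>The \<open>(b, c, d)\<close>-component of a trilinear form yields bilinear forms concentrated in the single
  components \<open>(bc, d)\<close> and \<open>(b, cd)\<close>. On both of them \<open>h\<^sub>a\<close> acts as \<open>1\<close> exactly if \<open>bcd = a\<close>, which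
  reduces coassociativity to associativity of the group.\<close>

lemma comult_fst_shift3:
  assumes "\<gamma> \<in> forms3 s h"
  shows "shift (h (bul b c)) (h d) (comult_fst (shift3 (h b) (h c) (h d) \<gamma>))
      = comult_fst (shift3 (h b) (h c) (h d) \<gamma>)"
    "shift (h b) (h (bul c d)) (comult_snd (shift3 (h b) (h c) (h d) \<gamma>))
      = comult_snd (shift3 (h b) (h c) (h d) \<gamma>)"
proof -
  obtain F where F: "finite F" "supports3 h F \<gamma>" using assms by (rule forms3_support)
  note slice = forms3_slice[OF assms F(2,1)]
  let ?\<gamma> = "shift3 (h b) (h c) (h d) \<gamma>"
  have eq: "(\<lambda>x' x''. ?\<gamma> x' x'' y) = shift (h b) (h c) (\<lambda>x y'. \<gamma> x y' (h d * y))"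
    "(\<lambda>x' x''. ?\<gamma> y x' x'') = shift (h c) (h d) (\<lambda>x y'. \<gamma> (h b * y) x y')"
    for y
    by (simp_all add: shift3_def shift_def)
  have "\<Delta> (h (bul b c) * x) (\<lambda>x' x''. ?\<gamma> x' x'' (h d * y)) = \<Delta> x (\<lambda>x' x''. ?\<gamma> x' x'' y)" for x y
    by (simp only: eq(1) h_h comult_idempotent[OF slice(1)] simp_thms if_True)
  then show "shift (h (bul b c)) (h d) (comult_fst ?\<gamma>) = comult_fst ?\<gamma>"
    by (simp only: shift_def comult_fst_def)
  have "\<Delta> (h (bul c d) * x) (\<lambda>x' x''. ?\<gamma> (h b * y) x' x'') = \<Delta> x (\<lambda>x' x''. ?\<gamma> y x' x'')" for x y
    by (simp only: eq(2) h_h comult_idempotent[OF slice(2)] simp_thms if_True)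
  then show "shift (h b) (h (bul c d)) (comult_snd ?\<gamma>) = comult_snd ?\<gamma>"
    by (simp only: shift_def comult_snd_def)
qed

lemma coassociative:
  assumes "\<gamma> \<in> forms3 s h"
  shows "\<Delta> x (comult_fst \<gamma>) = \<Delta> x (comult_snd \<gamma>)"
  using assms
proof (induction x arbitrary: \<gamma> rule: letter_induct)
  case one
  obtain F where F: "finite F" "supports3 h F \<gamma>" using one by (rule forms3_support)
  note slice = forms3_slice[OF one F(2,1)]
  have "comult_fst \<gamma> 1 1 = \<gamma> 1 1 1"
    unfolding comult_fst_def by (rule comult_simps(1)[OF slice(1)])
  moreover have "comult_snd \<gamma> 1 1 = \<gamma> 1 1 1"
    unfolding comult_snd_def by (rule comult_simps(1)[OF slice(2)])
  ultimately show ?case using one by (simp add: comult_fst_forms2)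
next
  case (add x y)
  then show ?case by (simp add: comult_fst_forms2)
next
  case (scale c x)
  then show ?case by (simp add: comult_fst_forms2)
next
  case (group_like g x)
  obtain F where F: "finite F" "supports3 h F \<gamma>" using group_like.prems by (rule forms3_support)
  let ?g = "gen g"
  note slice = forms3_slice[OF group_like.prems F(2,1)]
  have "shift ?g ?g (comult_fst \<gamma>) = comult_fst (shift3 ?g ?g ?g \<gamma>)"
    "shift ?g ?g (comult_snd \<gamma>) = comult_snd (shift3 ?g ?g ?g \<gamma>)"
    using slice group_like(1)
    by (simp_all add: fun_eq_iff comult_fst_def comult_snd_def shift_def shift3_def)
  with group_like show ?case by (simp add: comult_fst_forms2 shift3_forms3)
next
  case (idempotent a x)
  obtain F where F: "finite F" "supports3 h F \<gamma>" using idempotent.prems by (rule forms3_support)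
  note \<gamma> = idempotent.prems
  let ?\<gamma> = "\<lambda>(b, c, d). shift3 (h b) (h c) (h d) \<gamma>"
  have mem: "?\<gamma> p \<in> forms3 s h" for p
    using shift3_forms3[OF \<gamma>] by (simp add: case_prod_unfold)
  have "\<exists>K. finite K \<and> supports3 h K (?\<gamma> p)" for p
    using forms3_support[OF mem[of p]] by blast
  then obtain F' where F': "\<And>p. finite (F' p)" "\<And>p. supports3 h (F' p) (?\<gamma> p)"
    by metis
  note slice = forms3_slice[OF mem F'(2,1)]
  have slices: "(\<lambda>x' x''. \<gamma> x' x'' z) = (\<Sum>p\<in>F \<times> F \<times> F. (\<lambda>x' x''. ?\<gamma> p x' x'' z))"
    "(\<lambda>x' x''. \<gamma> z x' x'') = (\<Sum>p\<in>F \<times> F \<times> F. (\<lambda>x' x''. ?\<gamma> p z x' x''))" for z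
    by (intro ext, subst shift3_expand[OF \<gamma> F], simp add: sum_fun_apply case_prod_unfold)+
  have expand: "comult_fst \<gamma> = (\<Sum>p\<in>F \<times> F \<times> F. comult_fst (?\<gamma> p))"
    "comult_snd \<gamma> = (\<Sum>p\<in>F \<times> F \<times> F. comult_snd (?\<gamma> p))"
    unfolding comult_fst_def comult_snd_def
    by (intro ext, subst slices(1), subst comult_form_sum, rule slice(1), simp add: sum_fun_apply)
      (intro ext, subst slices(2), subst comult_form_sum, rule slice(2), simp add: sum_fun_apply)
  have "\<Delta> (h a * x) (comult_fst (?\<gamma> p)) = \<Delta> (h a * x) (comult_snd (?\<gamma> p))" for p
  proof -
    obtain b c d where p: "p = (b, c, d)" by (cases p)
    note mem' = comult_fst_forms2[OF mem, of p, unfolded p prod.case]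
    have "\<Delta> (h a * x) (comult_fst (?\<gamma> p)) = (if bul (bul b c) d = a then \<Delta> x (comult_fst (?\<gamma> p)) else 0)"
      using comult_idempotent[OF mem'(1), of a x "bul b c" d] comult_fst_shift3(1)[OF \<gamma>, of b c d] p
      by simp
    moreover have "\<Delta> (h a * x) (comult_snd (?\<gamma> p))
        = (if bul b (bul c d) = a then \<Delta> x (comult_snd (?\<gamma> p)) else 0)"
      using comult_idempotent[OF mem'(2), of a x b "bul c d"] comult_fst_shift3(2)[OF \<gamma>, of b c d] p
      by simp
    ultimately show ?thesis
      using idempotent.IH[OF mem, of p] by (simp only: X.assoc)
  qed
  then show ?case
    unfolding expand by (simp add: comult_form_sum comult_fst_forms2[OF mem] del: comult_simps)
qed

lemma comult_left_right: "comult_left s h \<Delta> (\<Delta> x) = comult_right s h \<Delta> (\<Delta> x)"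
  using coassociative[of _ x]
  by (auto simp: comult_left_def comult_right_def comult_fst_def comult_snd_def fun_eq_iff)

subsection \<open>Counit and antipode axioms\<close>

lemma counit_tensor_forms2:
  assumes "\<phi> \<in> forms1 s h"
  shows "(\<lambda>x y. \<epsilon> x * \<phi> y) \<in> forms2 s h" "(\<lambda>x y. \<epsilon> y * \<phi> x) \<in> forms2 s h"
proof -
  obtain F where F: "finite F" "\<And>x. vanishes_on h F x \<Longrightarrow> \<phi> x = 0"
    using assms by (rule forms1_support) blast
  have "\<epsilon> x = 0" "\<phi> x = 0" if "vanishes_on h (insert e F) x" for x
  proof -
    have "h e * x = 0" using that by (simp add: vanishes_on_def)
    then show "\<epsilon> x = 0" using counit_simps(5)[of e x] counit_simps(3)[of 0 0] by simp
    show "\<phi> x = 0" using that by (intro F(2)) (simp add: vanishes_on_def)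
  qed
  then have "supports2 h (insert e F) (\<lambda>x y. \<epsilon> x * \<phi> y)" "supports2 h (insert e F) (\<lambda>x y. \<epsilon> y * \<phi> x)"
    by (auto simp: supports2_def)
  with F(1) show "(\<lambda>x y. \<epsilon> x * \<phi> y) \<in> forms2 s h" "(\<lambda>x y. \<epsilon> y * \<phi> x) \<in> forms2 s h"
    by (auto intro!: forms2I[of _ "insert e F"] simp: forms1_simps[OF assms] algebra_simps)
qed

lemma comult_counit:
  assumes "\<phi> \<in> forms1 s h"
  shows "\<Delta> x (\<lambda>x y. \<epsilon> x * \<phi> y) = \<phi> x" "\<Delta> x (\<lambda>x y. \<epsilon> y * \<phi> x) = \<phi> x"
  using assms
proof (induction x arbitrary: \<phi> rule: letter_induct)
  case (group_like g x)
  { case 1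
    then have "(\<lambda>z. \<phi> (gen g * z)) \<in> forms1 s h" using forms1_translate[of \<phi> "gen g" 1] by simp
    with 1 group_like show ?case by (simp add: counit_tensor_forms2) (simp add: shift_def)
  next
    case 2
    then have "(\<lambda>z. \<phi> (gen g * z)) \<in> forms1 s h" using forms1_translate[of \<phi> "gen g" 1] by simp
    with 2 group_like show ?case by (simp add: counit_tensor_forms2) (simp add: shift_def) }
next
  case (idempotent a x)
  { case 1
    have "(\<lambda>z. \<phi> (h a * z)) \<in> forms1 s h" using forms1_translate[OF 1, of "h a" 1] by simp
    moreover have "decompose a (\<lambda>x y. \<epsilon> x * \<phi> y) = (\<lambda>x y. \<epsilon> x * \<phi> (h a * y))"
    proof (intro ext)
      fix x y
      show "decompose a (\<lambda>x y. \<epsilon> x * \<phi> y) x y = \<epsilon> x * \<phi> (h a * y)"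
        by (subst decompose_superset[of "{e}"]) simp_all
    qed
    ultimately show ?case using 1 idempotent by (simp add: counit_tensor_forms2)
  next
    case 2
    have "(\<lambda>z. \<phi> (h a * z)) \<in> forms1 s h" using forms1_translate[OF 2, of "h a" 1] by simp
    moreover have "decompose a (\<lambda>x y. \<epsilon> y * \<phi> x) = (\<lambda>x y. \<epsilon> y * \<phi> (h a * x))"
    proof (intro ext)
      fix x y
      have "bul (star b) a = e \<longleftrightarrow> b = a" for b
        by (metis X.left_inverse bul_eq_iff X.inverse_inverse X.right_neutral)
      then show "decompose a (\<lambda>x y. \<epsilon> y * \<phi> x) x y = \<epsilon> y * \<phi> (h a * x)"
        by (subst decompose_superset[of "{a}"]) simp_all
    qed
    ultimately show ?case using 2 idempotent by (simp add: counit_tensor_forms2) }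
qed (simp_all add: counit_tensor_forms2 forms1_simps)

lemma counit_axioms:
  "contracts_to s h (\<lambda>x y. s (\<epsilon> x) y) (\<Delta> z) z"
  "contracts_to s h (\<lambda>x y. s (\<epsilon> y) x) (\<Delta> z) z"
proof -
  have *: "(\<lambda>x y. \<phi> (s (\<epsilon> (h b * x)) (h c * y))) = shift (h b) (h c) (\<lambda>x y. \<epsilon> x * \<phi> y)"
    "(\<lambda>x y. \<phi> (s (\<epsilon> (h c * y)) (h b * x))) = shift (h b) (h c) (\<lambda>x y. \<epsilon> y * \<phi> x)"
    if "\<phi> \<in> forms1 s h" for \<phi> b c
    by (simp_all add: shift_def forms1_simps[OF that] del: counit_simps)
  show "contracts_to s h (\<lambda>x y. s (\<epsilon> x) y) (\<Delta> z) z"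
    using comult_components[OF counit_tensor_forms2(1)]
    by (intro contracts_toI) (simp add: * comult_counit del: counit_simps)
  show "contracts_to s h (\<lambda>x y. s (\<epsilon> y) x) (\<Delta> z) z"
    using comult_components[OF counit_tensor_forms2(2)]
    by (intro contracts_toI) (simp add: * comult_counit del: counit_simps)
qed

lemma antipode_forms2:
  assumes "\<phi> \<in> forms1 s h"
  shows "(\<lambda>x y. \<phi> (S (h b * x) * (h c * y))) \<in> forms2 s h"
    "(\<lambda>x y. \<phi> (h b * x * S (h c * y))) \<in> forms2 s h"
proof -
  have "S 0 = 0" using antipode_simps(3)[of 0 0] by simp
  then have "supports2 h {b, c} (\<lambda>x y. \<phi> (S (h b * x) * (h c * y)))"
    "supports2 h {b, c} (\<lambda>x y. \<phi> (h b * x * S (h c * y)))"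
    by (auto simp: supports2_def vanishes_on_def forms1_simps[OF assms] simp del: antipode_simps)
  then show "(\<lambda>x y. \<phi> (S (h b * x) * (h c * y))) \<in> forms2 s h"
    "(\<lambda>x y. \<phi> (h b * x * S (h c * y))) \<in> forms2 s h"
    by (auto intro!: forms2I[of _ "{b, c}"] simp: forms1_simps[OF assms] distrib_left distrib_right
        scale_mult_left scale_mult_right simp del: antipode_simps(4,5))
qed

text \<open>For a group-like \<open>g\<close> the component is \<open>h\<^sub>b g g\<^sup>-\<^sup>1 h\<^sub>c\<^sub>*\<close>, where \<open>c\<^sub>*\<close> is the inverse of \<open>c\<close>: the
  generators cancel and the indices must agree. So the components have a closed form that depends on
  \<open>x\<close> only through \<open>\<epsilon> x\<close>.\<close>

lemma comult_right_antipode: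
  assumes "\<phi> \<in> forms1 s h"
  shows "\<Delta> x (\<lambda>x y. \<phi> (h b * x * S (h c * y))) = (if c = star b then \<epsilon> x * \<phi> (h b) else 0)"
  using assms
proof (induction x arbitrary: \<phi> b c rule: letter_induct)
  case one
  have "b = star c \<longleftrightarrow> c = star b" by (metis X.inverse_inverse)
  with one show ?case
    by (simp add: antipode_forms2 del: antipode_simps(5)) (simp add: orthogonal forms1_simps[OF one])
next
  case (add x y)
  then show ?case by (simp add: antipode_forms2 distrib_right del: antipode_simps)
next
  case (scale d x)
  then show ?case by (simp add: antipode_forms2 del: antipode_simps)
next
  case (group_like g x)
  obtain b' where b: "b = \<pi> g b'" using \<pi>_surj[OF group_like(1)] .
  obtain c' where c: "c = \<pi> g c'" using \<pi>_surj[OF group_like(1)] .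
  have \<phi>': "(\<lambda>z. \<phi> (gen g * z * inv_gen g)) \<in> forms1 s h"
    using group_like.prems by (rule forms1_translate)
  have "h b * (gen g * x) * S (h c * (gen g * y)) = gen g * (h b' * x * S (h c' * y)) * inv_gen g"
    for x y
    using group_like(1) by (simp add: b c gen_h_left[symmetric] mult.assoc del: antipode_simps(5))
  then have "shift (gen g) (gen g) (\<lambda>x y. \<phi> (h b * x * S (h c * y)))
      = (\<lambda>x y. \<phi> (gen g * (h b' * x * S (h c' * y)) * inv_gen g))"
    by (simp add: shift_def del: antipode_simps)
  moreover have "gen g * h b' * inv_gen g = h b"
    using group_like(1) by (simp add: b gen_h mult.assoc gen_inv)
  ultimately show ?case
    using group_like.IH[OF \<phi>', of b' c'] group_like(1) group_like.prems
    by (simp add: antipode_forms2 b c \<pi>_star[symmetric] \<pi>_eq_iff del: antipode_simps)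
next
  case (idempotent a x)
  have "shift (h b) (h c) (\<lambda>x y. \<phi> (h b * x * S (h c * y))) = (\<lambda>x y. \<phi> (h b * x * S (h c * y)))"
    by (simp add: shift_def h_h del: antipode_simps)
  then have "\<Delta> (h a * x) (\<lambda>x y. \<phi> (h b * x * S (h c * y)))
      = (if bul b c = a then \<Delta> x (\<lambda>x y. \<phi> (h b * x * S (h c * y))) else 0)"
    using comult_idempotent[OF antipode_forms2(2)[OF idempotent.prems], of a x b c b c]
    by (simp del: antipode_simps comult_simps)
  then show ?case using idempotent.IH[OF idempotent.prems, of b c]
    by (auto simp del: antipode_simps comult_simps)
qed

lemma antipode_axiom_right: "contracts_to s h (\<lambda>x y. x * S y) (\<Delta> z) (s (\<epsilon> z) 1)"
proof (intro contracts_toI)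
  fix \<phi> assume \<phi>: "\<phi> \<in> forms1 s h"
  obtain F where F: "finite F" "\<And>x. vanishes_on h F x \<Longrightarrow> \<phi> x = 0"
    using \<phi> by (rule forms1_support) blast
  let ?t = "\<lambda>(b, c). \<Delta> z (\<lambda>x y. \<phi> (h b * x * S (h c * y)))"
  have t: "?t = (\<lambda>(b, c). if c = star b then \<epsilon> z * \<phi> (h b) else 0)"
    using comult_right_antipode[OF \<phi>] by simp
  have mem: "b \<in> F" if "\<phi> (h b) \<noteq> 0" for b
  proof (rule ccontr)
    assume "b \<notin> F"
    then have "vanishes_on h F (h b)" by (auto simp: vanishes_on_def orthogonal)
    with F(2) that show False by blast
  qed
  have sub: "{p. ?t p \<noteq> 0} \<subseteq> (\<lambda>b. (b, star b)) ` F"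
    unfolding t by (auto split: if_splits intro!: image_eqI[OF _ mem])
  have "Sum_any ?t = sum ?t ((\<lambda>b. (b, star b)) ` F)"
    using F(1) sub by (intro Sum_any.expand_superset) simp_all
  also have "\<dots> = (\<Sum>b\<in>F. \<epsilon> z * \<phi> (h b))"
    unfolding t by (subst sum.reindex) (auto simp: inj_on_def)
  also have "\<dots> = \<phi> (s (\<epsilon> z) 1)"
    using forms1_expand[OF \<phi> F, of 1] by (simp add: forms1_simps[OF \<phi>] sum_distrib_left)
  finally show "finite {(b, c). \<Delta> z (\<lambda>x y. \<phi> (h b * x * S (h c * y))) \<noteq> 0}
      \<and> Sum_any (\<lambda>(b, c). \<Delta> z (\<lambda>x y. \<phi> (h b * x * S (h c * y)))) = \<phi> (s (\<epsilon> z) 1)"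
    using finite_subset[OF sub] F(1) by (simp add: case_prod_unfold)
qed

text \<open>Here the components do depend on \<open>x\<close>: for a group-like \<open>g\<close> they are \<open>g\<^sup>-\<^sup>1 h\<^sub>b\<^sub>* h\<^sub>c g\<close>. Multiplying
  \<open>x\<close> by \<open>g\<close> permutes them through \<open>(b, c) \<mapsto> (\<pi> b, \<pi> c)\<close>, so that only their sum is preserved.\<close>

lemma comult_left_antipode:
  assumes "\<phi> \<in> forms1 s h"
  defines "t \<equiv> \<lambda>z (b, c). \<Delta> z (\<lambda>x y. \<phi> (S (h b * x) * (h c * y)))"
  shows "finite {p. t z p \<noteq> 0} \<and> Sum_any (t z) = \<epsilon> z * \<phi> 1"
proof (induction z rule: letter_induct)
  case one
  obtain F where F: "finite F" "\<And>x. vanishes_on h F x \<Longrightarrow> \<phi> x = 0"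
    using assms(1) by (rule forms1_support) blast
  have t: "t 1 = (\<lambda>(b, c). if b = star c then \<phi> (h c) else 0)"
  proof (intro ext, clarify)
    fix b c
    have "star b = c \<longleftrightarrow> b = star c" by (metis X.inverse_inverse)
    then show "t 1 (b, c) = (if b = star c then \<phi> (h c) else 0)"
      using assms(1) by (simp add: t_def antipode_forms2 del: antipode_simps(5))
        (simp add: orthogonal forms1_simps[OF assms(1)])
  qed
  have mem: "b \<in> F" if "\<phi> (h b) \<noteq> 0" for b
  proof (rule ccontr)
    assume "b \<notin> F"
    then have "vanishes_on h F (h b)" by (auto simp: vanishes_on_def orthogonal)
    with F(2) that show False by blast
  qed
  have sub: "{p. t 1 p \<noteq> 0} \<subseteq> (\<lambda>c. (star c, c)) ` F"
    unfolding t by (auto split: if_splits intro!: image_eqI[OF _ mem])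
  have "Sum_any (t 1) = sum (t 1) ((\<lambda>c. (star c, c)) ` F)"
    using F(1) sub by (intro Sum_any.expand_superset) simp_all
  also have "\<dots> = (\<Sum>c\<in>F. \<phi> (h c))"
    unfolding t by (subst sum.reindex) (auto simp: inj_on_def)
  also have "\<dots> = \<phi> 1"
    using forms1_expand[OF assms(1) F, of 1] by simp
  finally show ?case using finite_subset[OF sub] F(1) by simp
next
  case (add x y)
  have "t (x + y) = (\<lambda>p. t x p + t y p)"
    using assms(1) by (simp add: t_def antipode_forms2 case_prod_unfold del: antipode_simps)
  moreover from this have "{p. t (x + y) p \<noteq> 0} \<subseteq> {p. t x p \<noteq> 0} \<union> {p. t y p \<noteq> 0}" by auto
  ultimately show ?case
    using add by (auto simp: Sum_any.distrib distrib_right dest: finite_subset)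
next
  case (scale d x)
  have "t (s d x) = (\<lambda>p. d * t x p)"
    using assms(1) by (simp add: t_def antipode_forms2 case_prod_unfold del: antipode_simps)
  moreover from this have "{p. t (s d x) p \<noteq> 0} \<subseteq> {p. t x p \<noteq> 0}" by auto
  ultimately show ?case
    using scale by (auto simp: Sum_any_right_distrib[symmetric] mult.assoc dest: finite_subset)
next
  case (group_like g x)
  \<comment> \<open>The factors \<open>g\<^sup>-\<^sup>1\<close> and \<open>g\<close> meet in the middle.\<close>
  have "t (gen g * x) (\<pi> g b, \<pi> g c) = t x (b, c)" for b c
  proof -
    have "S (h (\<pi> g b) * (gen g * x)) * (h (\<pi> g c) * (gen g * y)) = S (h b * x) * (h c * y)" for x y
    proof -
      have "S (h (\<pi> g b) * (gen g * x)) * (h (\<pi> g c) * (gen g * y))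
          = S (h b * x) * (inv_gen g * gen g) * (h c * y)"
        using group_like(1) by (simp add: gen_h_left[symmetric] mult.assoc del: antipode_simps(5))
      then show ?thesis using group_like(1) by (simp add: inv_gen del: antipode_simps)
    qed
    then have "shift (gen g) (gen g) (\<lambda>x y. \<phi> (S (h (\<pi> g b) * x) * (h (\<pi> g c) * y)))
        = (\<lambda>x y. \<phi> (S (h b * x) * (h c * y)))"
      by (simp add: shift_def del: antipode_simps)
    then show ?thesis
      using assms(1) group_like(1) by (simp add: t_def antipode_forms2 del: antipode_simps)
  qed
  then have eq: "t (gen g * x) \<circ> map_prod (\<pi> g) (\<pi> g) = t x" by (simp add: fun_eq_iff)
  have bij: "bij (map_prod (\<pi> g) (\<pi> g))"
    using bij_\<pi>[OF group_like(1)] by (simp add: bij_def prod.inj_map map_prod_surj)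
  have "{p. t (gen g * x) p \<noteq> 0} = map_prod (\<pi> g) (\<pi> g) ` {p. t x p \<noteq> 0}"
  proof -
    have "map_prod (\<pi> g) (\<pi> g) -` {p. t (gen g * x) p \<noteq> 0} = {p. t x p \<noteq> 0}"
      by (simp only: eq[symmetric] vimage_def o_apply mem_Collect_eq)
    then show ?thesis using surj_image_vimage_eq[OF bij_is_surj[OF bij]] by metis
  qed
  moreover have "Sum_any (t (gen g * x)) = Sum_any (t x)"
    using bij eq by (rule Sum_any.reindex_cong)
  ultimately show ?case using group_like by simp
next
  case (idempotent a x)
  \<comment> \<open>Only components with \<open>c = star b\<close> are nonzero, and those have index product \<open>e\<close>.\<close>
  have "t (h a * x) (b, c) = (if a = e then t x (b, c) else 0)" for b c
  proof (cases "c = star b")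
    case True
    have "shift (h b) (h c) (\<lambda>x y. \<phi> (S (h b * x) * (h c * y))) = (\<lambda>x y. \<phi> (S (h b * x) * (h c * y)))"
      by (simp add: shift_def h_h del: antipode_simps)
    then show ?thesis
      using comult_idempotent[OF antipode_forms2(1)[OF assms(1)], of a x b c b c] True
      by (simp add: t_def del: antipode_simps comult_simps)
  next
    case False
    then have "(\<lambda>x y. \<phi> (S (h b * x) * (h c * y))) = 0"
      by (auto simp: fun_eq_iff mult.assoc h_h forms1_simps[OF assms(1)])
    then show ?thesis by (simp add: t_def comult_form_zero del: antipode_simps comult_simps)
  qed
  then have "t (h a * x) = (if a = e then t x else (\<lambda>_. 0))" by (auto simp: fun_eq_iff)
  with idempotent show ?case by simp
qed

lemma antipode_axiom_left: "contracts_to s h (\<lambda>x y. S x * y) (\<Delta> z) (s (\<epsilon> z) 1)"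
  using comult_left_antipode
  by (intro contracts_toI) (simp add: forms1_simps case_prod_unfold del: antipode_simps)

theorem hopf_algebra: "hopf_algebra s h \<Delta> \<epsilon> S"
proof -
  have "algebra_hom s (*) \<epsilon>"
    by (simp add: algebra_hom_def linear_map_iff vector_space_mult vector_space_axioms counit_mult)
  moreover have "Vector_Spaces.linear s s S"
    by (simp add: linear_map_iff vector_space_axioms)
  ultimately show ?thesis
    unfolding hopf_algebra_def
    using comultiplication_comult comult_left_right counit_axioms antipode_axiom_left
      antipode_axiom_right antipode_mult k_algebra_axioms
    by simp
qed

subsection \<open>Group-like elements and the universal R-matrix\<close>

lemma rack_R_matrix_eq:
  assumes "\<beta> \<in> forms2 s h"
  shows "rack_R_matrix s h q \<beta> = Sum_any (\<lambda>b. \<beta> (h b) (q b))"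
  using assms by (simp add: rack_R_matrix_def formal_sum_eq_Sum_any pure2_def)

lemma rack_R_matrix_superset:
  assumes "\<beta> \<in> forms2 s h" "finite F" "supports2 h F \<beta>"
  shows "rack_R_matrix s h q \<beta> = (\<Sum>b\<in>F. \<beta> (h b) (q b))"
  unfolding rack_R_matrix_eq[OF assms(1)] using supports2_outside(1)[OF assms(3), of _ 1]
  by (intro Sum_any.expand_superset assms(2)) auto

lemma rack_R_matrix_add:
  assumes "\<beta> \<in> forms2 s h" "\<beta>' \<in> forms2 s h"
  shows "rack_R_matrix s h q (\<beta> + \<beta>') = rack_R_matrix s h q \<beta> + rack_R_matrix s h q \<beta>'"
proof -
  obtain F where F: "finite F" "supports2 h F \<beta>" using assms(1) by (rule forms2_support)
  obtain F' where F': "finite F'" "supports2 h F' \<beta>'" using assms(2) by (rule forms2_support)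
  have "finite (F \<union> F')" "supports2 h (F \<union> F') \<beta>" "supports2 h (F \<union> F') \<beta>'"
    using F F' by (auto intro: supports2_mono[rotated])
  moreover from this have "supports2 h (F \<union> F') (\<beta> + \<beta>')" by (simp add: supports2_def)
  ultimately show ?thesis
    using assms comult_free.M_closed(2)[OF assms]
    by (simp add: rack_R_matrix_superset[of _ "F \<union> F'"] sum.distrib)
qed

lemma rack_R_matrix_scale:
  assumes "\<beta> \<in> forms2 s h"
  shows "rack_R_matrix s h q (form_scale c \<beta>) = c * rack_R_matrix s h q \<beta>"
proof -
  obtain F where F: "finite F" "supports2 h F \<beta>" using assms(1) by (rule forms2_support)
  then have "supports2 h F (form_scale c \<beta>)" by (simp add: supports2_def form_scale_def)
  with F show ?thesis
    using assms comult_free.M_closed(3)[OF assms, of c]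
    by (simp add: rack_R_matrix_superset[of _ F]) (simp add: form_scale_def sum_distrib_left)
qed

text \<open>Moving \<open>g \<otimes> g\<close> across \<open>h\<^sub>b \<otimes> q\<^sub>b\<close> turns \<open>b\<close> into \<open>\<pi>(b)\<close>; as \<open>\<pi>\<close> is a bijection, the sum over \<open>b\<close> does
  not change.\<close>

lemma group_like_commutes_R_matrix:
  assumes g: "g \<in> L" and q: "\<And>b. gen g * q b = q (\<pi> g b) * gen g"
  shows "mult2 s h (\<Delta> (gen g)) (rack_R_matrix s h q) = mult2 s h (rack_R_matrix s h q) (\<Delta> (gen g))"
proof
  fix \<beta>
  let ?R = "rack_R_matrix s h q" and ?g = "gen g"
  show "mult2 s h (\<Delta> ?g) ?R \<beta> = mult2 s h ?R (\<Delta> ?g) \<beta>"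
  proof (cases "\<beta> \<in> forms2 s h")
    case True
    obtain F where F: "finite F" "supports2 h F \<beta>" using True by (rule forms2_support)
    have left: "(\<lambda>x y. ?R (shift x y \<beta>)) \<in> forms2 s h"
      by (rule functional_shift_forms2(1)[OF True rack_R_matrix_add rack_R_matrix_scale F])
    have right: "(\<lambda>x y. \<Delta> ?g (shift x y \<beta>)) \<in> forms2 s h"
      by (rule comult_shift_forms2(1)[OF True F])
    have "mult2 s h (\<Delta> ?g) ?R \<beta> = \<Delta> ?g (\<lambda>x y. ?R (shift x y \<beta>))"
      using True by (simp add: mult2_def shift_def)
    also have "\<dots> = Sum_any (\<lambda>b. \<beta> (?g * h b) (?g * q b))"
      using left g True
      by (simp add: comult_group_like pure2_def rack_R_matrix_eq shift_forms2) (simp add: shift_def)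
    also have "\<dots> = Sum_any (\<lambda>b. \<beta> (h b * ?g) (q b * ?g))"
      by (rule Sum_any.reindex_cong[OF bij_\<pi>[OF g], symmetric]) (simp add: fun_eq_iff g gen_h q)
    also have "\<dots> = ?R (\<lambda>x y. \<Delta> ?g (shift x y \<beta>))"
      using right g True
      by (simp add: rack_R_matrix_eq) (simp add: comult_group_like pure2_def shift_forms2, simp add: shift_def)
    also have "\<dots> = mult2 s h ?R (\<Delta> ?g) \<beta>"
      using True by (simp add: mult2_def shift_def)
    finally show ?thesis .
  next
    case False
    then show ?thesis by (simp add: mult2_def)
  qed
qed

end

section \<open>Extending a comultiplication along a homomorphism\<close>

context permuted_idempotents
begin

lemma forms2_pullback:
  assumes "algebra_hom s\<^sub>0 s \<iota>" "\<And>a. \<iota> (h\<^sub>0 a) = h a" "\<beta> \<in> forms2 s h"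
    and alg: "k_algebra s\<^sub>0"
  shows "(\<lambda>x y. \<beta> (\<iota> x) (\<iota> y)) \<in> forms2 s\<^sub>0 h\<^sub>0"
proof -
  interpret A: k_algebra s\<^sub>0 by (rule alg)
  have \<iota>: "\<iota> (x + y) = \<iota> x + \<iota> y" "\<iota> (s\<^sub>0 c x) = s c (\<iota> x)" "\<iota> (x * y) = \<iota> x * \<iota> y" "\<iota> 0 = 0" for x y c
  proof -
    show eqs: "\<iota> (x + y) = \<iota> x + \<iota> y" "\<iota> (s\<^sub>0 c x) = s c (\<iota> x)" "\<iota> (x * y) = \<iota> x * \<iota> y" for x y c
      using assms(1) by (simp_all add: algebra_hom_def linear_map_iff)
    from eqs(1)[of 0 0] show "\<iota> 0 = 0" by simp
  qed
  obtain F where F: "finite F" "supports2 h F \<beta>" using assms(3) by (rule forms2_support)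
  have "vanishes_on h F (\<iota> x)" if "vanishes_on h\<^sub>0 F x" for x
    using that by (auto simp: vanishes_on_def assms(2)[symmetric] \<iota>(3)[symmetric] \<iota>(4))
  then have "supports2 h\<^sub>0 F (\<lambda>x y. \<beta> (\<iota> x) (\<iota> y))"
    using F(2) by (simp add: supports2_def)
  with F(1) show ?thesis
    by (intro A.forms2I[of _ F]) (simp_all add: \<iota> forms2_simps[OF assms(3)])
qed

text \<open>Both sides are multiplicative in \<open>x\<close>, hence it suffices to compare them on generators.\<close>

lemma comult_extends:
  assumes hom: "algebra_hom s\<^sub>0 s \<iota>" and h: "\<And>a. \<iota> (h\<^sub>0 a) = h a"
    and A: "presented_by s\<^sub>0 gen\<^sub>0 H\<^sub>0 Rel\<^sub>0" and \<Delta>\<^sub>0: "comultiplication s\<^sub>0 h\<^sub>0 \<Delta>\<^sub>0"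
    and gens: "\<And>g. \<Delta> (\<iota> (gen\<^sub>0 g)) = tensor_map s h \<iota> (\<Delta>\<^sub>0 (gen\<^sub>0 g))"
  shows "\<Delta> (\<iota> x) = tensor_map s h \<iota> (\<Delta>\<^sub>0 x)"
proof
  fix \<beta>
  interpret A: presented_algebra s\<^sub>0 gen\<^sub>0 H\<^sub>0 Rel\<^sub>0 by unfold_locales (rule A)
  note pullback = forms2_pullback[OF hom h _ A.k_algebra_axioms]
  have \<iota>: "\<iota> 1 = 1" "\<iota> (x + y) = \<iota> x + \<iota> y" "\<iota> (s\<^sub>0 c x) = s c (\<iota> x)" "\<iota> (x * y) = \<iota> x * \<iota> y" for x y c
    using hom by (simp_all add: algebra_hom_def linear_map_iff)
  have \<Delta>\<^sub>0_linear: "\<Delta>\<^sub>0 (x + y) \<beta> = \<Delta>\<^sub>0 x \<beta> + \<Delta>\<^sub>0 y \<beta>" "\<Delta>\<^sub>0 (s\<^sub>0 c x) \<beta> = c * \<Delta>\<^sub>0 x \<beta>"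
    if "\<beta> \<in> forms2 s\<^sub>0 h\<^sub>0" for \<beta> x y c
    using \<Delta>\<^sub>0 that by (auto simp: comultiplication_def A.forms1_iff A.linear_form_iff)
  have "\<Delta> (\<iota> x) \<beta> = \<Delta>\<^sub>0 x (\<lambda>y z. \<beta> (\<iota> y) (\<iota> z))" if "\<beta> \<in> forms2 s h" for \<beta>
    using that
  proof (induction x arbitrary: \<beta> rule: A.generators_induct)
    case one
    then show ?case using \<Delta>\<^sub>0 pullback[OF one] by (simp add: \<iota> comultiplication_def pure2_def)
  next
    case (add x y)
    then show ?case using pullback[OF add.prems] by (simp add: \<iota> \<Delta>\<^sub>0_linear)
  next
    case (scale c x)
    then show ?case using pullback[OF scale.prems] by (simp add: \<iota> \<Delta>\<^sub>0_linear)
  next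
    case (letter g x)
    obtain F where F: "finite F" "supports2 h F \<beta>" using letter.prems by (rule forms2_support)
    have "\<Delta> (\<iota> (gen\<^sub>0 g * x)) \<beta> = \<Delta> (\<iota> (gen\<^sub>0 g)) (\<lambda>y z. \<Delta> (\<iota> x) (shift y z \<beta>))"
      using letter.prems by (simp add: \<iota> comult_mult)
    also have "\<dots> = \<Delta>\<^sub>0 (gen\<^sub>0 g) (\<lambda>y z. \<Delta> (\<iota> x) (shift (\<iota> y) (\<iota> z) \<beta>))"
      using comult_shift_forms2(1)[OF letter.prems F] by (simp add: gens tensor_map_def)
    also have "\<dots> = \<Delta>\<^sub>0 (gen\<^sub>0 g) (\<lambda>y z. \<Delta>\<^sub>0 x (\<lambda>y' z'. \<beta> (\<iota> (y * y')) (\<iota> (z * z'))))"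
      using letter.prems by (simp add: letter.IH shift_forms2) (simp add: shift_def \<iota>)
    also have "\<dots> = \<Delta>\<^sub>0 (gen\<^sub>0 g * x) (\<lambda>y z. \<beta> (\<iota> y) (\<iota> z))"
      using \<Delta>\<^sub>0 pullback[OF letter.prems] by (simp add: comultiplication_def mult2_def)
    finally show ?case .
  qed
  then show "\<Delta> (\<iota> x) \<beta> = tensor_map s h \<iota> (\<Delta>\<^sub>0 x) \<beta>"
    by (auto simp: tensor_map_def) (simp add: \<Delta>_def)
qed

end

section \<open>The set-theoretic Yang-Baxter algebra\<close>

lemma monomial_Nil: "monomial [] = 1"
  unfolding monomial_def zero_list_def[symmetric] by (rule single_one)

lemma commute_inverse:
  fixes x y g g' :: "'a::monoid_mult"
  assumes "g * g' = 1" "g' * g = 1" "g * x = y * g"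
  shows "g' * y = x * g'"
proof -
  have "g' * y = g' * (y * g) * g'" using assms(1) by (simp add: mult.assoc)
  also have "\<dots> = x * g'" using assms(2) by (simp add: assms(3)[symmetric] mult.assoc[symmetric])
  finally show ?thesis .
qed

text \<open>Inverses and permutations are attached to the group-like letters; the value \<open>0\<close> here and \<open>id\<close>
  below, on the letters \<open>HGen\<close>, are placeholders.\<close>

definition yb_inverse :: "('x \<Rightarrow> 'b::zero) \<Rightarrow> ('x \<Rightarrow> 'b) \<Rightarrow> ('x \<Rightarrow> 'b) \<Rightarrow> ('x \<Rightarrow> 'b) \<Rightarrow> 'x yb_gen \<Rightarrow> 'b" where
  "yb_inverse q qi w wi = case_yb_gen (case_quandle_gen qi q (\<lambda>_. 0)) wi w"

definition yb_permutation ::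
  "('x \<Rightarrow> 'x \<Rightarrow> 'x) \<Rightarrow> ('x \<Rightarrow> 'x) \<Rightarrow> ('x \<Rightarrow> 'x \<Rightarrow> 'x) \<Rightarrow> 'x yb_gen \<Rightarrow> 'x \<Rightarrow> 'x" where
  "yb_permutation bul star \<sigma> = case_yb_gen
     (case_quandle_gen (\<lambda>b a. bul (bul b a) (star b)) (\<lambda>b a. bul (bul (star b) a) b) (\<lambda>_. id))
     \<sigma> (\<lambda>a. inv (\<sigma> a))"

text \<open>From \<open>a \<bullet> b = b \<bullet> (b \<triangleright> a)\<close> it follows that \<open>b \<triangleright> a\<close> is the conjugate \<open>b\<^sub>* \<bullet> a \<bullet> b\<close>. So \<open>q\<^sub>b\<close> permutes the
  idempotents through conjugation by \<open>b\<close>, and \<open>w\<^sub>a\<close> does so through \<open>\<sigma>\<^sub>a\<close>; the relations of the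
  inverse letters follow by cancellation.\<close>

theorem yang_baxter_permuted_idempotents:
  fixes rhd bul \<sigma> \<tau> :: "'x \<Rightarrow> 'x \<Rightarrow> 'x" and s :: "'k::field \<Rightarrow> 'b::ring_1 \<Rightarrow> 'b"
  assumes "group bul e star" and conj: "\<And>a b. bul a b = bul b (rhd b a)"
    and yang_baxter: "yang_baxter_algebra s rhd bul \<sigma> \<tau> q qi h w wi"
    and \<sigma>_hom: "\<And>a b x. bul (\<sigma> x a) (\<sigma> x b) = \<sigma> x (bul a b)"
  shows "permuted_idempotents s (case_yb_gen (case_quandle_gen q qi h) w wi)
    (\<lambda>a. QuandleGen (HGen a)) (yb_relations rhd bul \<sigma> \<tau>) bul e star h (- range (\<lambda>a. QuandleGen (HGen a)))
    (yb_inverse q qi w wi) (yb_permutation bul star \<sigma>)"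
proof -
  interpret X: group bul e star by (rule assms(1))
  let ?gen = "case_yb_gen (case_quandle_gen q qi h) w wi"
  let ?H = "\<lambda>a :: 'x. QuandleGen (HGen a)"
  let ?Rel = "yb_relations rhd bul \<sigma> \<tau> :: ('x yb_gen list \<Rightarrow>\<^sub>0 'k) set"
  let ?L = "- range ?H"
  interpret presented_algebra s ?gen ?H ?Rel
    using yang_baxter by unfold_locales (simp add: yang_baxter_algebra_def)
  have cancel: "bul (star b) (bul b c) = c" "bul b (bul (star b) c) = c" for b c
    by (simp_all add: X.assoc[symmetric])
  have rhd: "rhd b a = bul (bul (star b) a) b" for a b
    using conj[of a b] cancel(1)[of b "rhd b a"] by (simp add: X.assoc)
  have \<sigma>: "bij (\<sigma> a)" for a using yang_baxter by (simp add: yang_baxter_algebra_def)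
  let ?Q = "\<lambda>a :: 'x. QuandleGen (QGen a)" and ?Qi = "\<lambda>a :: 'x. QuandleGen (QInvGen a)"
  have mem: "monomial [?Qi a, ?Q a] - monomial [] \<in> ?Rel" "monomial [?Q a, ?Qi a] - monomial [] \<in> ?Rel"
    "monomial [WInvGen a, WGen a] - monomial [] \<in> ?Rel"
    "monomial [WGen a, WInvGen a] - monomial [] \<in> ?Rel"
    "monomial [?Q b, ?H (rhd b a)] - monomial [?H a, ?Q b] \<in> ?Rel"
    "monomial [WGen a, ?H b] - monomial [?H (\<sigma> a b), WGen a] \<in> ?Rel"
    "monomial [?H a, ?H b] - (if a = b then monomial [?H a] else 0) \<in> ?Rel" for a b
    unfolding yb_relations_def quandle_relations_def Let_def monomial_Nil by blast+
  have qi_q: "qi a * q a = 1" and q_qi: "q a * qi a = 1" for a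
    using relation_equation[OF mem(1)] relation_equation[OF mem(2)] by simp_all
  have wi_w: "wi a * w a = 1" and w_wi: "w a * wi a = 1" for a
    using relation_equation[OF mem(3)] relation_equation[OF mem(4)] by simp_all
  have "evaluate s ?gen (monomial [?H a, ?H b] - (if a = b then monomial [?H a] else 0)) = 0" for a b
    unfolding evaluate_eq_0_iff
    by (rule relation_ideal.relation[OF mem(7)])
  then have h_h: "h a * h b = (if a = b then h a else 0)" for a b
    by (cases "a = b") (simp_all add: evaluate_diff evaluate_monomial evaluate_zero)
  have q_h: "q b * h (rhd b a) = h a * q b" for a b
    using relation_equation[OF mem(5)] by simp
  have w_h: "w a * h b = h (\<sigma> a b) * w a" for a b
    using relation_equation[OF mem(6)] by simp
  show ?thesis
  proof unfold_locales
    show "inj ?H" by (simp add: inj_def)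
  next
    fix g assume "g \<in> ?L"
    then show "?gen g * yb_inverse q qi w wi g = 1" "yb_inverse q qi w wi g * ?gen g = 1"
      by (auto simp: yb_inverse_def q_qi qi_q w_wi wi_w split: yb_gen.split quandle_gen.split)
  next
    fix g assume "g \<in> ?L"
    have "bij (\<lambda>a. bul (bul b a) (star b))" "bij (\<lambda>a. bul (bul (star b) a) b)" for b
      by (rule o_bij[of "\<lambda>a. bul (bul (star b) a) b"], simp_all add: fun_eq_iff X.assoc cancel)
        (rule o_bij[of "\<lambda>a. bul (bul b a) (star b)"], simp_all add: fun_eq_iff X.assoc cancel)
    then show "bij (yb_permutation bul star \<sigma> g)"
      by (auto simp: yb_permutation_def \<sigma> bij_imp_bij_inv split: yb_gen.split quandle_gen.split)
  next
    fix g a b assume "g \<in> ?L"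
    have "inv (\<sigma> x) (bul a b) = bul (inv (\<sigma> x) a) (inv (\<sigma> x) b)" for x
      using \<sigma>[of x] \<sigma>_hom[of x "inv (\<sigma> x) a" "inv (\<sigma> x) b"]
      by (simp add: bij_inv_eq_iff surj_f_inv_f bij_is_surj inv_f_f bij_is_inj)
    then show "yb_permutation bul star \<sigma> g (bul a b)
        = bul (yb_permutation bul star \<sigma> g a) (yb_permutation bul star \<sigma> g b)"
      by (auto simp: yb_permutation_def \<sigma>_hom X.assoc cancel split: yb_gen.split quandle_gen.split)
  next
    fix g b assume g: "g \<in> ?L"
    have "q x * h b = h (bul (bul x b) (star x)) * q x" for x
      using q_h[of x "bul (bul x b) (star x)"] by (simp add: rhd X.assoc cancel)
    moreover have "qi x * h b = h (bul (bul (star x) b) x) * qi x" for x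
      using commute_inverse[OF q_qi qi_q q_h, of x b] by (simp add: rhd)
    moreover have "wi x * h b = h (inv (\<sigma> x) b) * wi x" for x
      using commute_inverse[OF w_wi wi_w w_h, of x "inv (\<sigma> x) b"] \<sigma>[of x]
      by (simp add: surj_f_inv_f bij_is_surj)
    ultimately show "?gen g * h b = h (yb_permutation bul star \<sigma> g b) * ?gen g"
      using g by (auto simp: yb_permutation_def w_h split: yb_gen.split quandle_gen.split)
  next
    let ?words = "\<lambda>r :: 'x yb_gen list \<Rightarrow>\<^sub>0 'k.
      \<exists>v w. set v \<subseteq> ?L \<and> set w \<subseteq> ?L \<and> r = monomial v - monomial w"
    let ?orthogonal = "\<lambda>r :: 'x yb_gen list \<Rightarrow>\<^sub>0 'k.
      \<exists>a b. r = monomial [?H a, ?H b] - (if a = b then monomial [?H a] else 0)"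
    let ?permute = "\<lambda>r :: 'x yb_gen list \<Rightarrow>\<^sub>0 'k. \<exists>g b. g \<in> ?L
      \<and> r = monomial [g, ?H b] - monomial [?H (yb_permutation bul star \<sigma> g b), g]"
    have L: "?Q a \<in> ?L" "?Qi a \<in> ?L" "WGen a \<in> ?L" "WInvGen a \<in> ?L" for a
      by auto
    have words: "?words (monomial [x, y] - monomial [x', y'])" "?words (monomial [x, y] - monomial [x'])"
      "?words (monomial [x, y] - monomial [])" if "x \<in> ?L" "y \<in> ?L" "x' \<in> ?L" "y' \<in> ?L" for x y x' y'
      by (rule exI[of _ "[x, y]"], rule exI[of _ "[x', y']"], use that in simp)
        (rule exI[of _ "[x, y]"], rule exI[of _ "[x']"], use that in simp,
          rule exI[of _ "[x, y]"], rule exI[of _ "[]"], use that in simp)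
    have permute: "?permute (monomial [?Q b, ?H (rhd b a)] - monomial [?H a, ?Q b])"
      "?permute (monomial [WGen a, ?H b] - monomial [?H (\<sigma> a b), WGen a])" for a b
    proof -
      have "bul (bul b (rhd b a)) (star b) = a"
        unfolding conj[symmetric] by (simp add: X.assoc)
      then have "yb_permutation bul star \<sigma> (?Q b) (rhd b a) = a"
        by (simp add: yb_permutation_def)
      then show "?permute (monomial [?Q b, ?H (rhd b a)] - monomial [?H a, ?Q b])"
        by (intro exI[of _ "?Q b"] exI[of _ "rhd b a"]) auto
      show "?permute (monomial [WGen a, ?H b] - monomial [?H (\<sigma> a b), WGen a])"
        by (intro exI[of _ "WGen a"] exI[of _ b]) (auto simp: yb_permutation_def)
    qed
    fix r assume "r \<in> ?Rel"
    then show "?words r \<or> ?orthogonal r \<or> ?permute r"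
      unfolding yb_relations_def quandle_relations_def Let_def monomial_Nil[symmetric]
      by (elim UnE CollectE exE conjE)
        (hypsubst, ((rule disjI1, (rule words; rule L))
          | (rule disjI2, rule disjI2, rule permute) | (rule disjI2, rule disjI1, intro exI, rule refl)))+
  qed (simp_all add: h_h)
qed

theorem proposition5p19:
  fixes rhd bul \<sigma> \<tau> :: "'x::countable \<Rightarrow> 'x \<Rightarrow> 'x" and e :: 'x and star :: "'x \<Rightarrow> 'x"
    and s\<^sub>0 :: "'k::field \<Rightarrow> 'a::ring_1 \<Rightarrow> 'a" and q\<^sub>0 qi\<^sub>0 h\<^sub>0 :: "'x \<Rightarrow> 'a"
    and s :: "'k \<Rightarrow> 'b::ring_1 \<Rightarrow> 'b" and q qi h w wi :: "'x \<Rightarrow> 'b"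
    and \<iota> :: "'a \<Rightarrow> 'b"
    and \<Delta>\<^sub>0 :: "'a \<Rightarrow> ('k, 'a) tensor2" and \<epsilon>\<^sub>0 :: "'a \<Rightarrow> 'k" and S\<^sub>0 :: "'a \<Rightarrow> 'a"
  assumes group: "group bul e star"
    and quandle: "quandle_algebra s\<^sub>0 rhd bul q\<^sub>0 qi\<^sub>0 h\<^sub>0"
    and yang_baxter: "yang_baxter_algebra s rhd bul \<sigma> \<tau> q qi h w wi"
    and canonical_map: "algebra_hom s\<^sub>0 s \<iota>"
      "\<And>a. \<iota> (q\<^sub>0 a) = q a" "\<And>a. \<iota> (qi\<^sub>0 a) = qi a" "\<And>a. \<iota> (h\<^sub>0 a) = h a"
    and hopf\<^sub>0: "hopf_algebra s\<^sub>0 h\<^sub>0 \<Delta>\<^sub>0 \<epsilon>\<^sub>0 S\<^sub>0"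
      "quasi_triangular s\<^sub>0 h\<^sub>0 \<Delta>\<^sub>0 (rack_R_matrix s\<^sub>0 h\<^sub>0 q\<^sub>0)"
    and \<Delta>\<^sub>0: "\<And>a. \<Delta>\<^sub>0 (q\<^sub>0 a) = pure2 s\<^sub>0 h\<^sub>0 (q\<^sub>0 a) (q\<^sub>0 a)"
      "\<And>a. \<Delta>\<^sub>0 (qi\<^sub>0 a) = pure2 s\<^sub>0 h\<^sub>0 (qi\<^sub>0 a) (qi\<^sub>0 a)"
      "\<And>a. \<Delta>\<^sub>0 (h\<^sub>0 a) = formal_sum {(b, c). bul b c = a} (\<lambda>(b, c). pure2 s\<^sub>0 h\<^sub>0 (h\<^sub>0 b) (h\<^sub>0 c))"
    and \<epsilon>\<^sub>0: "\<And>a. \<epsilon>\<^sub>0 (q\<^sub>0 a) = 1" "\<And>a. \<epsilon>\<^sub>0 (qi\<^sub>0 a) = 1"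
      "\<And>a. \<epsilon>\<^sub>0 (h\<^sub>0 a) = (if a = e then 1 else 0)"
    and S\<^sub>0: "\<And>a. S\<^sub>0 (q\<^sub>0 a) = qi\<^sub>0 a" "\<And>a. S\<^sub>0 (qi\<^sub>0 a) = q\<^sub>0 a" "\<And>a. S\<^sub>0 (h\<^sub>0 a) = h\<^sub>0 (star a)"
    and \<sigma>_hom: "\<And>a b x. bul (\<sigma> x a) (\<sigma> x b) = \<sigma> x (bul a b)"
  shows "\<exists>\<Delta> \<epsilon> S.
      (hopf_algebra s h \<Delta> \<epsilon> S
       \<and> (\<forall>x. \<Delta> (\<iota> x) = tensor_map s h \<iota> (\<Delta>\<^sub>0 x)) \<and> (\<forall>x. \<epsilon> (\<iota> x) = \<epsilon>\<^sub>0 x) \<and> (\<forall>x. S (\<iota> x) = \<iota> (S\<^sub>0 x))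
       \<and> (\<forall>a. \<Delta> (w a) = pure2 s h (w a) (w a)))
    \<and> (\<forall>a. mult2 s h (\<Delta> (w a)) (rack_R_matrix s h q) = mult2 s h (rack_R_matrix s h q) (\<Delta> (w a)))"
proof -
  let ?gen = "case_yb_gen (case_quandle_gen q qi h) w wi"
  let ?gen\<^sub>0 = "case_quandle_gen q\<^sub>0 qi\<^sub>0 h\<^sub>0"
  let ?Rel = "yb_relations rhd bul \<sigma> \<tau> :: ('x yb_gen list \<Rightarrow>\<^sub>0 'k) set"
  let ?Rel\<^sub>0 = "quandle_relations rhd bul QGen QInvGen HGen :: ('x quandle_gen list \<Rightarrow>\<^sub>0 'k) set"
  let ?H = "\<lambda>a :: 'x. QuandleGen (HGen a)"
  have conj: "\<And>a b. bul a b = bul b (rhd b a)" and A: "presented_by s\<^sub>0 ?gen\<^sub>0 HGen ?Rel\<^sub>0"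
    using quandle unfolding quandle_algebra_def by blast+
  interpret A: presented_algebra s\<^sub>0 ?gen\<^sub>0 HGen ?Rel\<^sub>0 by unfold_locales (rule A)
  interpret Y: permuted_idempotents s ?gen ?H ?Rel bul e star h "- range ?H"
    "yb_inverse q qi w wi" "yb_permutation bul star \<sigma>"
    by (rule yang_baxter_permuted_idempotents; fact)
  have \<iota>: "\<iota> 1 = 1" "\<iota> (x + y) = \<iota> x + \<iota> y" "\<iota> (s\<^sub>0 c x) = s c (\<iota> x)" "\<iota> (x * y) = \<iota> x * \<iota> y" for x y c
    using canonical_map(1) by (simp_all add: algebra_hom_def linear_map_iff)
  have \<epsilon>\<^sub>0_hom: "\<epsilon>\<^sub>0 1 = 1" "\<epsilon>\<^sub>0 (x + y) = \<epsilon>\<^sub>0 x + \<epsilon>\<^sub>0 y" "\<epsilon>\<^sub>0 (s\<^sub>0 c x) = c * \<epsilon>\<^sub>0 x"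
    "\<epsilon>\<^sub>0 (x * y) = \<epsilon>\<^sub>0 x * \<epsilon>\<^sub>0 y" for x y c
    using hopf\<^sub>0(1) by (simp_all add: hopf_algebra_def algebra_hom_def linear_map_iff)
  have S\<^sub>0_anti: "S\<^sub>0 1 = 1" "S\<^sub>0 (x + y) = S\<^sub>0 x + S\<^sub>0 y" "S\<^sub>0 (s\<^sub>0 c x) = s\<^sub>0 c (S\<^sub>0 x)"
    "S\<^sub>0 (x * y) = S\<^sub>0 y * S\<^sub>0 x" for x y c
    using hopf\<^sub>0(1) by (simp_all add: hopf_algebra_def linear_map_iff)
  have comult_gen: "Y.\<Delta> (q a) = pure2 s h (q a) (q a)" "Y.\<Delta> (qi a) = pure2 s h (qi a) (qi a)"
    "Y.\<Delta> (w a) = pure2 s h (w a) (w a)" for a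
    using Y.comult_group_like[of "QuandleGen (QGen a)"] Y.comult_group_like[of "QuandleGen (QInvGen a)"]
      Y.comult_group_like[of "WGen a"] by auto
  have counit_gen: "Y.\<epsilon> (q a) = 1" "Y.\<epsilon> (qi a) = 1" "Y.\<epsilon> (h a) = (if a = e then 1 else 0)" for a
    using Y.counit_simps(4)[of "QuandleGen (QGen a)" 1] Y.counit_simps(4)[of "QuandleGen (QInvGen a)" 1]
      Y.counit_simps(5)[of a 1] by auto
  have inverse_gen: "yb_inverse q qi w wi (QuandleGen (QGen a)) = qi a"
    "yb_inverse q qi w wi (QuandleGen (QInvGen a)) = q a" for a
    by (simp_all add: yb_inverse_def)
  have antipode_gen: "Y.S (q a) = qi a" "Y.S (qi a) = q a" for a
    using Y.antipode_simps(4)[of "QuandleGen (QGen a)" 1] Y.antipode_simps(4)[of "QuandleGen (QInvGen a)" 1]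
      inverse_gen by auto
  have letters: "Y.\<Delta> (\<iota> (?gen\<^sub>0 g)) = tensor_map s h \<iota> (\<Delta>\<^sub>0 (?gen\<^sub>0 g))" for g
  proof
    fix \<beta>
    have "(\<lambda>x y. \<beta> (\<iota> x) (\<iota> y)) \<in> forms2 s\<^sub>0 h\<^sub>0" if "\<beta> \<in> forms2 s h"
      using Y.forms2_pullback[OF canonical_map(1,4) that A.k_algebra_axioms] .
    then show "Y.\<Delta> (\<iota> (?gen\<^sub>0 g)) \<beta> = tensor_map s h \<iota> (\<Delta>\<^sub>0 (?gen\<^sub>0 g)) \<beta>"
      by (cases g) (simp_all add: canonical_map \<Delta>\<^sub>0 comult_gen Y.comult_idempotent_letter tensor_map_def
          formal_sum_def pure2_def case_prod_unfold)
  qed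
  have "comultiplication s\<^sub>0 h\<^sub>0 \<Delta>\<^sub>0" using hopf\<^sub>0(1) by (simp add: hopf_algebra_def)
  then have comult: "Y.\<Delta> (\<iota> x) = tensor_map s h \<iota> (\<Delta>\<^sub>0 x)" for x
    by (rule Y.comult_extends[OF canonical_map(1,4) A _ letters])
  have counit: "Y.\<epsilon> (\<iota> x) = \<epsilon>\<^sub>0 x" for x
  proof (induction x rule: A.generators_induct)
    case (letter g x)
    then show ?case
      by (cases g) (simp_all add: \<iota> \<epsilon>\<^sub>0_hom \<epsilon>\<^sub>0 canonical_map Y.counit_mult counit_gen)
  qed (simp_all add: \<iota> \<epsilon>\<^sub>0_hom)
  have antipode: "Y.S (\<iota> x) = \<iota> (S\<^sub>0 x)" for x
  proof (induction x rule: A.generators_induct)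
    case (letter g x)
    then show ?case
      by (cases g) (simp_all add: \<iota> S\<^sub>0_anti S\<^sub>0 canonical_map Y.antipode_mult antipode_gen)
  qed (simp_all add: \<iota> S\<^sub>0_anti)
  have w_q: "w a * q b = q (\<sigma> a b) * w a" for a b
    using Y.relation_equation[of "[WGen a, QuandleGen (QGen b)]" "[QuandleGen (QGen (\<sigma> a b)), WGen a]"]
    by (auto simp: yb_relations_def Let_def)
  have "mult2 s h (Y.\<Delta> (w a)) (rack_R_matrix s h q) = mult2 s h (rack_R_matrix s h q) (Y.\<Delta> (w a))" for a
    using Y.group_like_commutes_R_matrix[of "WGen a" q] by (simp add: w_q yb_permutation_def image_iff)
  with Y.hopf_algebra comult counit antipode comult_gen(3) show ?thesis
    by (intro exI[of _ Y.\<Delta>] exI[of _ Y.\<epsilon>] exI[of _ Y.S]) simp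
qed

end
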